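(* Let $R$ be a commutative noetherian local ring whose maximal ideal $\mathfrak{m}$ is decomposable as an $R$-module. Let $M$ be a finitely generated $R$-module with infinite projective dimension. Then $\mathfrak{m}$ is (isomorphic to) a direct summand of $\Omega^3M\oplus\Omega^4M\oplus\Omega^5M$.
   Context: $\mathfrak{m}$ is decomposable if $\mathfrak{m}=I\oplus J$ for some non-zero ideals $I,J$ of $R$. $\Omega^nM=\Omega^n_RM$ denotes the $n$-th syzygy of $M$ in its minimal free resolution over $R$. *)

theory Defs
  imports "HOL-Algebra.Algebra" "HOL-Library.Extended_Nat"
begin

section \<open>Local rings and decomposable ideals\<close>

definition local_ring :: "('a, 'm) ring_scheme \<Rightarrow> 'a set \<Rightarrow> bool"
  where "local_ring R \<mm> \<longleftrightarrow>
    cring R \<and> maximalideal \<mm> R \<and> (\<forall>J. maximalideal J R \<longrightarrow> J = \<mm>)"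

definition decomposable_ideal :: "('a, 'm) ring_scheme \<Rightarrow> 'a set \<Rightarrow> bool"
  where "decomposable_ideal R K \<longleftrightarrow>
    (\<exists>I J. ideal I R \<and> ideal J R \<and> I \<noteq> {\<zero>\<^bsub>R\<^esub>} \<and> J \<noteq> {\<zero>\<^bsub>R\<^esub>} \<and>
      I \<inter> J = {\<zero>\<^bsub>R\<^esub>} \<and> I <+>\<^bsub>R\<^esub> J = K)"


section \<open>Modules\<close>

text \<open>
  Records of type \<^typ>\<open>('a, 'b) module\<close> inherit the fields \<open>mult\<close> and \<open>one\<close> from rings; they play no
  role for modules, and none of the notions below depends on them.
\<close>

definition ideal_module :: "('a, 'm) ring_scheme \<Rightarrow> 'a set \<Rightarrow> ('a, 'a) module"
  where "ideal_module R I =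
    ring.extend (ring.truncate (R\<lparr>carrier := I\<rparr>)) \<lparr>smult = (\<otimes>\<^bsub>R\<^esub>)\<rparr>"

definition direct_sum ::
  "('a, 'b, 'm) module_scheme \<Rightarrow> ('a, 'c, 'n) module_scheme \<Rightarrow> ('a, 'b \<times> 'c) module"
  where "direct_sum M N =
    ring.extend (RDirProd M N) \<lparr>smult = (\<lambda>a (x, y). (a \<odot>\<^bsub>M\<^esub> x, a \<odot>\<^bsub>N\<^esub> y))\<rparr>"

definition module_hom ::
  "('a, 'm) ring_scheme \<Rightarrow> ('a, 'b, 'n) module_scheme \<Rightarrow> ('a, 'c, 'k) module_scheme \<Rightarrow> ('b \<Rightarrow> 'c) set"
  where "module_hom R M N =
    {h \<in> carrier M \<rightarrow> carrier N.
      (\<forall>x \<in> carrier M. \<forall>y \<in> carrier M. h (x \<oplus>\<^bsub>M\<^esub> y) = h x \<oplus>\<^bsub>N\<^esub> h y) \<and>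
      (\<forall>a \<in> carrier R. \<forall>x \<in> carrier M. h (a \<odot>\<^bsub>M\<^esub> x) = a \<odot>\<^bsub>N\<^esub> h x)}"

definition module_isomorphic ::
  "('a, 'm) ring_scheme \<Rightarrow> ('a, 'b, 'n) module_scheme \<Rightarrow> ('a, 'c, 'k) module_scheme \<Rightarrow> bool"
  where "module_isomorphic R M N \<longleftrightarrow>
    (\<exists>h \<in> module_hom R M N. bij_betw h (carrier M) (carrier N))"

definition isomorphic_to_direct_summand ::
  "('a, 'm) ring_scheme \<Rightarrow> ('a, 'b, 'n) module_scheme \<Rightarrow> ('a, 'c, 'k) module_scheme \<Rightarrow> bool"
  where "isomorphic_to_direct_summand R N M \<longleftrightarrow>
    (\<exists>A B. submodule A R M \<and> submodule B R M \<and>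
      A \<inter> B = {\<zero>\<^bsub>M\<^esub>} \<and> A <+>\<^bsub>M\<^esub> B = carrier M \<and>
      module_isomorphic R N (M\<lparr>carrier := A\<rparr>))"

definition submodule_generated ::
  "('a, 'm) ring_scheme \<Rightarrow> ('a, 'b, 'n) module_scheme \<Rightarrow> 'b set \<Rightarrow> 'b set"
  where "submodule_generated R M S = \<Inter>{N. submodule N R M \<and> S \<subseteq> N}"

definition finitely_generated_module ::
  "('a, 'm) ring_scheme \<Rightarrow> ('a, 'b, 'n) module_scheme \<Rightarrow> bool"
  where "finitely_generated_module R M \<longleftrightarrow>
    module R M \<and>
    (\<exists>S. finite S \<and> S \<subseteq> carrier M \<and> submodule_generated R M S = carrier M)"

definition ideal_times_module ::
  "('a, 'm) ring_scheme \<Rightarrow> 'a set \<Rightarrow> ('a, 'b, 'n) module_scheme \<Rightarrow> 'b set"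
  where "ideal_times_module R I M =
    submodule_generated R M {a \<odot>\<^bsub>M\<^esub> x | a x. a \<in> I \<and> x \<in> carrier M}"

definition finite_rank_free_module ::
  "('a, 'm) ring_scheme \<Rightarrow> ('a, 'b, 'n) module_scheme \<Rightarrow> bool"
  where "finite_rank_free_module R F \<longleftrightarrow>
    module R F \<and>
    (\<exists>B. finite B \<and> B \<subseteq> carrier F \<and>
      (\<forall>x \<in> carrier F. \<exists>!c. c \<in> B \<rightarrow>\<^sub>E carrier R \<and> x = (\<Oplus>\<^bsub>F\<^esub>b\<in>B. c b \<odot>\<^bsub>F\<^esub> b)))"

text \<open>
  HOL cannot quantify over the modules on all types, so the lifting property is tested on modules
  over one fixed type. Since \<^typ>\<open>('a + 'p) list\<close> is infinite and at least as large as \<^typ>\<open>'a\<close> and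
  \<^typ>\<open>'p\<close>, it holds copies of \<open>P\<close> and of the free module on the elements of \<open>P\<close>. The surjection from
  the latter onto the former is therefore among the tested ones, and as soon as it splits, \<open>P\<close> has
  the lifting property for modules on arbitrary types.
\<close>

definition projective_module :: "('a, 'm) ring_scheme \<Rightarrow> ('a, 'p, 'n) module_scheme \<Rightarrow> bool"
  where "projective_module R P \<longleftrightarrow>
    module R P \<and>
    (\<forall>(A :: ('a, ('a + 'p) list) module) (B :: ('a, ('a + 'p) list) module) g f.
      module R A \<and> module R B \<and>
      g \<in> module_hom R A B \<and> g ` carrier A = carrier B \<and> f \<in> module_hom R P B \<longrightarrow>
      (\<exists>h \<in> module_hom R P A. \<forall>x \<in> carrier P. g (h x) = f x))"


section \<open>Resolutions, projective dimension and syzygies\<close>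

text \<open>
  Exactness of \<open>\<dots> \<rightarrow> F 2 \<rightarrow> F 1 \<rightarrow> F 0 \<rightarrow> M \<rightarrow> 0\<close> with differentials \<open>d n : F n \<rightarrow> F (n - 1)\<close> for
  \<open>n \<ge> 1\<close> and augmentation \<open>e : F 0 \<rightarrow> M\<close>. The value \<open>d 0\<close> is not used.
\<close>

definition resolution ::
  "('a, 'm) ring_scheme \<Rightarrow> ('a, 'b, 'n) module_scheme \<Rightarrow>
    (nat \<Rightarrow> ('a, 'c, 'k) module_scheme) \<Rightarrow> (nat \<Rightarrow> 'c \<Rightarrow> 'c) \<Rightarrow> ('c \<Rightarrow> 'b) \<Rightarrow> bool"
  where "resolution R M F d e \<longleftrightarrow>
    module R M \<and> (\<forall>n. module R (F n)) \<and>
    e \<in> module_hom R (F 0) M \<and>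
    (\<forall>n. d (Suc n) \<in> module_hom R (F (Suc n)) (F n)) \<and>
    e ` carrier (F 0) = carrier M \<and>
    d 1 ` carrier (F 1) = a_kernel (F 0) M e \<and>
    (\<forall>n. d (Suc (Suc n)) ` carrier (F (Suc (Suc n))) = a_kernel (F (Suc n)) (F n) (d (Suc n)))"

text \<open>
  The type \<^typ>\<open>('a + 'b) list\<close> is infinite and at least as large as \<^typ>\<open>'a\<close> and \<^typ>\<open>'b\<close>. Iterating free
  modules on the elements of the previous kernel, starting from \<open>M\<close>, never leaves this cardinality,
  so if \<open>M\<close> has a projective resolution of length \<open>n\<close> at all, it has one on this type.
\<close>

definition proj_dim :: "('a, 'm) ring_scheme \<Rightarrow> ('a, 'b, 'n) module_scheme \<Rightarrow> enat"
  where "proj_dim R M =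
    Inf {enat n | n.
      \<exists>(P :: nat \<Rightarrow> ('a, ('a + 'b) list) module) d e.
        resolution R M P d e \<and> (\<forall>i. projective_module R (P i)) \<and>
        (\<forall>i>n. carrier (P i) = {\<zero>\<^bsub>P i\<^esub>})}"

text \<open>For \<open>R\<close> local with maximal ideal \<open>\<mm>\<close> and \<open>M\<close> finitely generated:\<close>

definition minimal_free_resolution ::
  "('a, 'm) ring_scheme \<Rightarrow> 'a set \<Rightarrow> ('a, 'b, 'n) module_scheme \<Rightarrow>
    (nat \<Rightarrow> ('a, 'c, 'k) module_scheme) \<Rightarrow> (nat \<Rightarrow> 'c \<Rightarrow> 'c) \<Rightarrow> ('c \<Rightarrow> 'b) \<Rightarrow> bool"
  where "minimal_free_resolution R \<mm> M F d e \<longleftrightarrow>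
    resolution R M F d e \<and> (\<forall>n. finite_rank_free_module R (F n)) \<and>
    (\<forall>n. d (Suc n) ` carrier (F (Suc n)) \<subseteq> ideal_times_module R \<mm> (F n))"

text \<open>The \<open>n\<close>-th syzygy for \<open>n \<ge> 1\<close>, namely the image of \<open>d n\<close> as a submodule of \<open>F (n - 1)\<close>.\<close>

definition syzygy ::
  "(nat \<Rightarrow> ('a, 'c, 'k) module_scheme) \<Rightarrow> (nat \<Rightarrow> 'c \<Rightarrow> 'c) \<Rightarrow> nat \<Rightarrow> ('a, 'c, 'k) module_scheme"
  where "syzygy F d n = (F (n - 1))\<lparr>carrier := d n ` carrier (F n)\<rparr>"

end

theory Submission
  imports Defs
begin

text \<open>
  Write \<open>\<mm> = I \<oplus> J\<close>; then \<open>I J = 0\<close>. Let \<open>K n\<close> be the \<open>n\<close>-th syzygy. Since \<open>K 2 \<subseteq> \<mm> F 1\<close> is the kernel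
  of a map of free modules, it splits as \<open>K 2 = (K 2 \<inter> I F 1) \<oplus> (K 2 \<inter> J F 1)\<close>, and it is non-zero because
  the projective dimension is infinite. Say \<open>C = K 2 \<inter> I F 1\<close> is non-zero; it is killed by \<open>J\<close>.

  If a non-zero direct summand \<open>C\<close> of \<open>K n\<close> is killed by \<open>J\<close>, then \<open>J\<close> is a direct summand of \<open>K (n + 1)\<close>:
  by Nakayama's lemma some \<open>y \<in> F n\<close> outside \<open>\<mm> F n\<close> is mapped into \<open>C\<close>, so \<open>J y \<subseteq> K (n + 1)\<close>, and
  a functional with value 1 at \<open>y\<close>, followed by the projection \<open>\<mm> \<rightarrow> J\<close>, retracts \<open>K (n + 1)\<close> onto a copy
  of \<open>J\<close>. Hence \<open>J\<close> is a summand of \<open>K 3\<close>. As \<open>J\<close> is killed by \<open>I\<close>, the same argument makes \<open>I\<close> a summand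
  of \<open>K 4\<close>, so that \<open>\<mm>\<close> is already a summand of \<open>K 3 \<oplus> K 4\<close>.
\<close>

section \<open>Homomorphisms and retracts\<close>

lemma module_homI:
  assumes "\<And>x. x \<in> carrier M \<Longrightarrow> h x \<in> carrier N"
    and "\<And>x y. x \<in> carrier M \<Longrightarrow> y \<in> carrier M \<Longrightarrow> h (x \<oplus>\<^bsub>M\<^esub> y) = h x \<oplus>\<^bsub>N\<^esub> h y"
    and "\<And>a x. a \<in> carrier R \<Longrightarrow> x \<in> carrier M \<Longrightarrow> h (a \<odot>\<^bsub>M\<^esub> x) = a \<odot>\<^bsub>N\<^esub> h x"
  shows "h \<in> module_hom R M N"
  using assms by (auto simp: module_hom_def)

lemma module_homD:
  assumes "h \<in> module_hom R M N"
  shows "x \<in> carrier M \<Longrightarrow> h x \<in> carrier N"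
    and "x \<in> carrier M \<Longrightarrow> y \<in> carrier M \<Longrightarrow> h (x \<oplus>\<^bsub>M\<^esub> y) = h x \<oplus>\<^bsub>N\<^esub> h y"
    and "a \<in> carrier R \<Longrightarrow> x \<in> carrier M \<Longrightarrow> h (a \<odot>\<^bsub>M\<^esub> x) = a \<odot>\<^bsub>N\<^esub> h x"
  using assms by (auto simp: module_hom_def)

lemma module_hom_comp:
  assumes "h \<in> module_hom R M N" and "k \<in> module_hom R N P"
  shows "(\<lambda>x. k (h x)) \<in> module_hom R M P"
  using module_homD[OF assms(1)] module_homD[OF assms(2)] by (intro module_homI) auto

lemma module_hom_zero:
  assumes "module R M" and "module R N" and "h \<in> module_hom R M N"
  shows "h \<zero>\<^bsub>M\<^esub> = \<zero>\<^bsub>N\<^esub>"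
proof -
  interpret M: module R M by fact
  interpret N: module R N by fact
  have "h (\<zero>\<^bsub>R\<^esub> \<odot>\<^bsub>M\<^esub> \<zero>\<^bsub>M\<^esub>) = \<zero>\<^bsub>R\<^esub> \<odot>\<^bsub>N\<^esub> h \<zero>\<^bsub>M\<^esub>"
    by (rule module_homD(3)[OF assms(3)]) auto
  then show ?thesis
    using module_homD(1)[OF assms(3)] by simp
qed

lemma module_hom_minus:
  assumes "module R M" and "module R N" and "h \<in> module_hom R M N" and "x \<in> carrier M"
  shows "h (\<ominus>\<^bsub>M\<^esub> x) = \<ominus>\<^bsub>N\<^esub> h x"
proof -
  interpret M: module R M by fact
  interpret N: module R N by fact
  have "h (\<ominus>\<^bsub>M\<^esub> x) \<oplus>\<^bsub>N\<^esub> h x = \<zero>\<^bsub>N\<^esub>"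
    using module_homD(2)[OF assms(3), of "\<ominus>\<^bsub>M\<^esub> x" x] assms(4) module_hom_zero[OF assms(1-3)]
    by (simp add: M.M.l_neg)
  then show ?thesis
    using module_homD(1)[OF assms(3)] assms(4) by (intro N.M.minus_equality[symmetric]) auto
qed

lemma module_hom_finsum:
  assumes "module R M" and "module R N" and h: "h \<in> module_hom R M N"
    and "finite A" and "f \<in> A \<rightarrow> carrier M"
  shows "h (\<Oplus>\<^bsub>M\<^esub>i\<in>A. f i) = (\<Oplus>\<^bsub>N\<^esub>i\<in>A. h (f i))"
proof -
  interpret M: module R M by fact
  interpret N: module R N by fact
  show ?thesis using assms(4,5)
  proof (induction A)
    case empty
    then show ?case using module_hom_zero[OF assms(1-3)] by simp
  next
    case (insert i A)
    then have f: "f \<in> A \<rightarrow> carrier M" "f i \<in> carrier M" by auto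
    have hf: "(\<lambda>i. h (f i)) \<in> A \<rightarrow> carrier N" using f module_homD(1)[OF h] by auto
    have "h (\<Oplus>\<^bsub>M\<^esub>i\<in>insert i A. f i) = h (f i \<oplus>\<^bsub>M\<^esub> (\<Oplus>\<^bsub>M\<^esub>i\<in>A. f i))"
      using insert f by simp
    also have "\<dots> = h (f i) \<oplus>\<^bsub>N\<^esub> h (\<Oplus>\<^bsub>M\<^esub>i\<in>A. f i)"
      using f by (intro module_homD(2)[OF h] M.M.finsum_closed)
    also have "\<dots> = h (f i) \<oplus>\<^bsub>N\<^esub> (\<Oplus>\<^bsub>N\<^esub>i\<in>A. h (f i))"
      using insert f by simp
    also have "\<dots> = (\<Oplus>\<^bsub>N\<^esub>i\<in>insert i A. h (f i))"
      using insert(1,2) hf f module_homD(1)[OF h] by (subst N.M.finsum_insert) auto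
    finally show ?case .
  qed
qed

section \<open>Kernels and images of homomorphisms\<close>

lemma submodule_kernel:
  assumes "module R M" and "module R N" and "h \<in> module_hom R M N"
  shows "submodule (a_kernel M N h) R M"
proof -
  interpret M: module R M by fact
  interpret N: module R N by fact
  show ?thesis
    using module_homD[OF assms(3)] module_hom_zero[OF assms] module_hom_minus[OF assms]
    by (intro M.submoduleI) (auto simp: a_kernel_def')
qed

lemma submodule_image:
  assumes "module R M" and "module R N" and h: "h \<in> module_hom R M N"
  shows "submodule (h ` carrier M) R N"
proof -
  interpret M: module R M by fact
  interpret N: module R N by fact
  show ?thesis
  proof (rule N.submoduleI)
    show "\<zero>\<^bsub>N\<^esub> \<in> h ` carrier M" using module_hom_zero[OF assms] by force
  next
    fix a b assume "a \<in> h ` carrier M" "b \<in> h ` carrier M"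
    then show "a \<oplus>\<^bsub>N\<^esub> b \<in> h ` carrier M"
      using module_homD(2)[OF h] by (smt (verit, best) M.add.m_closed image_iff)
  next
    fix a x assume "a \<in> carrier R" "x \<in> h ` carrier M"
    then show "a \<odot>\<^bsub>N\<^esub> x \<in> h ` carrier M"
      using module_homD(3)[OF h] by (smt (verit, best) M.smult_closed image_iff)
  next
    fix a assume "a \<in> h ` carrier M"
    then show "\<ominus>\<^bsub>N\<^esub> a \<in> h ` carrier M"
      using module_hom_minus[OF assms] by (smt (verit, best) M.add.inv_closed image_iff)
  qed (use module_homD(1)[OF h] in auto)
qed

text \<open>A direct summand up to isomorphism, encoded by an inclusion \<open>h\<close> and a left
  inverse \<open>r\<close>. Such pairs compose and can be added without choosing a complement; the
  internal form with submodules is produced only at the very end.\<close>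

definition module_retract ::
  "('a, 'm) ring_scheme \<Rightarrow> ('a, 'b, 'n) module_scheme \<Rightarrow> ('a, 'c, 'k) module_scheme \<Rightarrow> bool"
  where "module_retract R N M \<longleftrightarrow>
    (\<exists>h \<in> module_hom R N M. \<exists>r \<in> module_hom R M N. \<forall>x \<in> carrier N. r (h x) = x)"

text \<open>The complement of the image of \<open>h\<close> is the kernel of \<open>r\<close>,
  because every \<open>x\<close> is the sum of \<open>h (r x)\<close> and an element killed by
  \<open>r\<close>.\<close>

lemma module_retract_imp_direct_summand:
  assumes "module R N" and "module R M" and "module_retract R N M"
  shows "isomorphic_to_direct_summand R N M"
proof -
  interpret N: module R N by fact
  interpret M: module R M by fact
  obtain h r where h: "h \<in> module_hom R N M" and r: "r \<in> module_hom R M N"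
    and rh: "\<And>x. x \<in> carrier N \<Longrightarrow> r (h x) = x"
    using assms(3) unfolding module_retract_def by blast
  let ?A = "h ` carrier N" and ?B = "a_kernel M N r"
  have 1: "submodule ?A R M" by (rule submodule_image[OF assms(1,2) h])
  have 2: "submodule ?B R M" by (rule submodule_kernel[OF assms(2,1) r])
  have 3: "?A \<inter> ?B = {\<zero>\<^bsub>M\<^esub>}"
  proof -
    have "\<zero>\<^bsub>M\<^esub> \<in> ?A" using module_hom_zero[OF assms(1,2) h] by force
    moreover have "\<zero>\<^bsub>M\<^esub> \<in> ?B" using module_hom_zero[OF assms(2,1) r] by (simp add: a_kernel_def')
    moreover have "z = \<zero>\<^bsub>M\<^esub>" if "z \<in> ?A" "z \<in> ?B" for z
      using that rh module_hom_zero[OF assms(1,2) h] by (auto simp: a_kernel_def')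
    ultimately show ?thesis by blast
  qed
  have 4: "?A <+>\<^bsub>M\<^esub> ?B = carrier M"
  proof
    show "?A <+>\<^bsub>M\<^esub> ?B \<subseteq> carrier M"
      using module_homD(1)[OF h] by (auto simp: set_add_def' a_kernel_def')
    show "carrier M \<subseteq> ?A <+>\<^bsub>M\<^esub> ?B"
    proof
      fix x assume x: "x \<in> carrier M"
      let ?a = "h (r x)"
      have a: "?a \<in> carrier M" "r x \<in> carrier N"
        using x module_homD(1)[OF h] module_homD(1)[OF r] by auto
      have "r (\<ominus>\<^bsub>M\<^esub> ?a \<oplus>\<^bsub>M\<^esub> x) = \<zero>\<^bsub>N\<^esub>"
        using a x module_homD(2)[OF r] module_hom_minus[OF assms(2,1) r] rh by (simp add: N.M.l_neg)
      then have "\<ominus>\<^bsub>M\<^esub> ?a \<oplus>\<^bsub>M\<^esub> x \<in> ?B" using a x by (simp add: a_kernel_def')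
      moreover have "x = ?a \<oplus>\<^bsub>M\<^esub> (\<ominus>\<^bsub>M\<^esub> ?a \<oplus>\<^bsub>M\<^esub> x)"
        using a x by (simp add: M.M.r_neg2)
      ultimately show "x \<in> ?A <+>\<^bsub>M\<^esub> ?B"
        unfolding set_add_def' using a by blast
    qed
  qed
  have "bij_betw h (carrier N) (carrier (M\<lparr>carrier := ?A\<rparr>))"
    using rh by (auto simp: bij_betw_def intro: inj_on_inverseI)
  moreover have "h \<in> module_hom R N (M\<lparr>carrier := ?A\<rparr>)"
    using module_homD[OF h] by (intro module_homI) auto
  ultimately show ?thesis
    unfolding isomorphic_to_direct_summand_def module_isomorphic_def
    using 1 2 3 4 by blast
qed

section \<open>Direct sums, and ideals as modules\<close>

lemma direct_sum_simps [simp]: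
  "carrier (direct_sum M N) = carrier M \<times> carrier N"
  "\<zero>\<^bsub>direct_sum M N\<^esub> = (\<zero>\<^bsub>M\<^esub>, \<zero>\<^bsub>N\<^esub>)"
  "(x, y) \<oplus>\<^bsub>direct_sum M N\<^esub> (x', y') = (x \<oplus>\<^bsub>M\<^esub> x', y \<oplus>\<^bsub>N\<^esub> y')"
  "a \<odot>\<^bsub>direct_sum M N\<^esub> (x, y) = (a \<odot>\<^bsub>M\<^esub> x, a \<odot>\<^bsub>N\<^esub> y)"
  by (simp_all add: direct_sum_def RDirProd_def DirProd_def ring.defs monoid.defs)

lemma module_direct_sum:
  assumes "module R M" and "module R N"
  shows "module R (direct_sum M N)"
proof -
  interpret M: module R M by fact
  interpret N: module R N by fact
  show ?thesis
  proof (intro moduleI abelian_groupI)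
    fix x assume "x \<in> carrier (direct_sum M N)"
    then show "\<exists>y\<in>carrier (direct_sum M N). y \<oplus>\<^bsub>direct_sum M N\<^esub> x = \<zero>\<^bsub>direct_sum M N\<^esub>"
      by (intro bexI[of _ "(\<ominus>\<^bsub>M\<^esub> fst x, \<ominus>\<^bsub>N\<^esub> snd x)"]) (auto simp: M.M.l_neg N.M.l_neg)
  qed (auto simp: M.M.a_ac N.M.a_ac M.smult_l_distr N.smult_l_distr M.smult_r_distr N.smult_r_distr
      M.smult_assoc1 N.smult_assoc1 M.R.is_cring)
qed

lemma ideal_module_simps [simp]:
  "carrier (ideal_module R I) = I"
  "\<zero>\<^bsub>ideal_module R I\<^esub> = \<zero>\<^bsub>R\<^esub>"
  "x \<oplus>\<^bsub>ideal_module R I\<^esub> y = x \<oplus>\<^bsub>R\<^esub> y"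
  "a \<odot>\<^bsub>ideal_module R I\<^esub> x = a \<otimes>\<^bsub>R\<^esub> x"
  by (simp_all add: ideal_module_def ring.defs)

lemma module_ideal_module:
  assumes "cring R" and "ideal I R"
  shows "module R (ideal_module R I)"
proof -
  interpret cring R by fact
  interpret ideal I R by fact
  show ?thesis
  proof (intro moduleI abelian_groupI)
    fix x assume "x \<in> carrier (ideal_module R I)"
    then show "\<exists>y\<in>carrier (ideal_module R I). y \<oplus>\<^bsub>ideal_module R I\<^esub> x = \<zero>\<^bsub>ideal_module R I\<^esub>"
      by (intro bexI[of _ "\<ominus>\<^bsub>R\<^esub> x"]) (auto simp: l_neg Icarr)
  qed (auto simp: Icarr a_ac l_distr r_distr m_assoc I_l_closed is_cring)
qed

section \<open>Coordinates\<close>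

locale free_basis = module R F for R :: "('a, 'm) ring_scheme" (structure)
    and F :: "('a, 'c, 'k) module_scheme" (structure) +
  fixes B :: "'c set"
  assumes finite_basis: "finite B" and basis_closed: "B \<subseteq> carrier F"
    and unique_coord: "x \<in> carrier F \<Longrightarrow>
      \<exists>!c. c \<in> B \<rightarrow>\<^sub>E carrier R \<and> x = (\<Oplus>\<^bsub>F\<^esub>b\<in>B. c b \<odot>\<^bsub>F\<^esub> b)"
begin

definition coord :: "'c \<Rightarrow> 'c \<Rightarrow> 'a"
  where "coord x = (THE c. c \<in> B \<rightarrow>\<^sub>E carrier R \<and> x = (\<Oplus>\<^bsub>F\<^esub>b\<in>B. c b \<odot>\<^bsub>F\<^esub> b))"

definition comb :: "('c \<Rightarrow> 'a) \<Rightarrow> 'c"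
  where "comb c = (\<Oplus>\<^bsub>F\<^esub>b\<in>B. c b \<odot>\<^bsub>F\<^esub> b)"

text \<open>For an ideal \<open>K\<close> this is the submodule \<open>K F\<close>, described
  coordinatewise. In this form a splitting of \<mm> splits \<mm> \<open>F\<close> one coordinate at
  a time.\<close>

definition with_coords_in :: "'a set \<Rightarrow> 'c set"
  where "with_coords_in K = {x \<in> carrier F. \<forall>b\<in>B. coord x b \<in> K}"

lemma coord_props:
  assumes "x \<in> carrier F"
  shows "coord x \<in> B \<rightarrow>\<^sub>E carrier R \<and> x = (\<Oplus>\<^bsub>F\<^esub>b\<in>B. coord x b \<odot>\<^bsub>F\<^esub> b)"
  unfolding coord_def by (rule theI'[OF unique_coord[OF assms]])

lemma coord_closed: "x \<in> carrier F \<Longrightarrow> b \<in> B \<Longrightarrow> coord x b \<in> carrier R"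
  using coord_props by blast

lemma comb_coord: "x \<in> carrier F \<Longrightarrow> comb (coord x) = x"
  using coord_props by (simp add: comb_def)

lemma comb_cong: "(\<And>b. b \<in> B \<Longrightarrow> c b = c' b) \<Longrightarrow> c' \<in> B \<rightarrow> carrier R \<Longrightarrow> comb c = comb c'"
  unfolding comb_def using basis_closed by (intro M.finsum_cong') auto

lemma comb_closed: "c \<in> B \<rightarrow> carrier R \<Longrightarrow> comb c \<in> carrier F"
  unfolding comb_def using basis_closed by (intro M.finsum_closed) auto

lemma coord_comb:
  assumes "c \<in> B \<rightarrow> carrier R" and "b \<in> B"
  shows "coord (comb c) b = c b"
proof -
  \<comment> \<open>Uniqueness of coordinates concerns extensional functions only, so
    \<open>c\<close> is first cut off outside \<open>B\<close>.\<close>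
  have "comb (restrict c B) = comb c"
    using assms by (intro comb_cong) auto
  then have "restrict c B \<in> B \<rightarrow>\<^sub>E carrier R \<and> comb c = (\<Oplus>\<^bsub>F\<^esub>b\<in>B. restrict c B b \<odot>\<^bsub>F\<^esub> b)"
    using assms by (simp add: comb_def)
  then have "coord (comb c) = restrict c B"
    using unique_coord[OF comb_closed[OF assms(1)]] coord_props[OF comb_closed[OF assms(1)]] by blast
  then show ?thesis using assms by simp
qed

lemma eq_if_coord_eq:
  assumes "x \<in> carrier F" "y \<in> carrier F" "\<And>b. b \<in> B \<Longrightarrow> coord x b = coord y b"
  shows "x = y"
proof -
  have "comb (coord x) = comb (coord y)"
    using assms coord_closed by (intro comb_cong) auto
  then show ?thesis
    using comb_coord[OF assms(1)] comb_coord[OF assms(2)] by argo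
qed

lemma comb_add:
  assumes "c \<in> B \<rightarrow> carrier R" "c' \<in> B \<rightarrow> carrier R"
  shows "comb (\<lambda>b. c b \<oplus> c' b) = comb c \<oplus>\<^bsub>F\<^esub> comb c'"
proof -
  have "comb (\<lambda>b. c b \<oplus> c' b) = (\<Oplus>\<^bsub>F\<^esub>b\<in>B. (c b \<odot>\<^bsub>F\<^esub> b) \<oplus>\<^bsub>F\<^esub> (c' b \<odot>\<^bsub>F\<^esub> b))"
    unfolding comb_def using assms basis_closed
    by (intro M.finsum_cong') (auto simp: Pi_iff subset_iff intro!: smult_l_distr)
  also have "\<dots> = comb c \<oplus>\<^bsub>F\<^esub> comb c'"
    unfolding comb_def using assms basis_closed by (intro M.finsum_addf) auto
  finally show ?thesis .
qed

lemma comb_smult: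
  assumes "c \<in> B \<rightarrow> carrier R" "a \<in> carrier R"
  shows "comb (\<lambda>b. a \<otimes> c b) = a \<odot>\<^bsub>F\<^esub> comb c"
proof -
  have "comb (\<lambda>b. a \<otimes> c b) = (\<Oplus>\<^bsub>F\<^esub>b\<in>B. a \<odot>\<^bsub>F\<^esub> (c b \<odot>\<^bsub>F\<^esub> b))"
    unfolding comb_def using assms basis_closed
    by (intro M.finsum_cong') (auto simp: Pi_iff subset_iff intro!: smult_assoc1)
  also have "\<dots> = a \<odot>\<^bsub>F\<^esub> comb c"
    unfolding comb_def using assms basis_closed finite_basis
    by (intro finsum_smult_ldistr[symmetric]) auto
  finally show ?thesis .
qed

lemma coord_add:
  assumes "x \<in> carrier F" "y \<in> carrier F" "b \<in> B"
  shows "coord (x \<oplus>\<^bsub>F\<^esub> y) b = coord x b \<oplus> coord y b"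
proof -
  have "x \<oplus>\<^bsub>F\<^esub> y = comb (\<lambda>b. coord x b \<oplus> coord y b)"
    using assms coord_closed comb_coord by (subst comb_add) auto
  then show ?thesis
    using assms coord_closed by (simp add: coord_comb)
qed

lemma coord_smult:
  assumes "x \<in> carrier F" "a \<in> carrier R" "b \<in> B"
  shows "coord (a \<odot>\<^bsub>F\<^esub> x) b = a \<otimes> coord x b"
proof -
  have "a \<odot>\<^bsub>F\<^esub> x = comb (\<lambda>b. a \<otimes> coord x b)"
    using assms coord_closed comb_coord by (subst comb_smult) auto
  then show ?thesis
    using assms coord_closed by (simp add: coord_comb)
qed

lemma coord_minus:
  assumes "x \<in> carrier F" "b \<in> B"
  shows "coord (\<ominus>\<^bsub>F\<^esub> x) b = \<ominus> coord x b"
proof -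
  have "\<ominus>\<^bsub>F\<^esub> x = (\<ominus> \<one>) \<odot>\<^bsub>F\<^esub> x"
    using assms by (simp add: smult_l_minus)
  then show ?thesis
    using assms coord_closed by (simp add: coord_smult l_minus)
qed

lemma coord_zero: "b \<in> B \<Longrightarrow> coord \<zero>\<^bsub>F\<^esub> b = \<zero>"
  using coord_smult[of "\<zero>\<^bsub>F\<^esub>" \<zero> b] coord_closed[of "\<zero>\<^bsub>F\<^esub>" b] by simp

lemma submodule_with_coords_in:
  assumes "ideal K R"
  shows "submodule (with_coords_in K) R F"
proof -
  interpret K: ideal K R by fact
  show ?thesis
    by (rule submoduleI)
      (auto simp: with_coords_in_def coord_zero coord_minus coord_add coord_smult K.I_l_closed)
qed

text \<open>The generators have all their coordinates in \<open>K\<close>, and the right-hand side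
  is a submodule. This turns the minimality condition on a resolution into a condition on
  coordinates.\<close>

lemma ideal_times_module_subset:
  assumes "ideal K R"
  shows "ideal_times_module R K F \<subseteq> with_coords_in K"
proof -
  interpret K: ideal K R by fact
  have "{a \<odot>\<^bsub>F\<^esub> x | a x. a \<in> K \<and> x \<in> carrier F} \<subseteq> with_coords_in K"
    by (auto simp: with_coords_in_def coord_smult coord_closed K.I_r_closed K.Icarr)
  then show ?thesis
    unfolding ideal_times_module_def submodule_generated_def
    using submodule_with_coords_in[OF assms] by blast
qed

section \<open>Homomorphisms out of a finite-rank free module\<close>

lemma hom_eq_sum:
  assumes "module R N" and h: "h \<in> module_hom R F N" and x: "x \<in> carrier F"
  shows "h x = (\<Oplus>\<^bsub>N\<^esub>b\<in>B. coord x b \<odot>\<^bsub>N\<^esub> h b)"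
proof -
  interpret N: module R N by fact
  have "h x = h (\<Oplus>\<^bsub>F\<^esub>b\<in>B. coord x b \<odot>\<^bsub>F\<^esub> b)"
    using comb_coord[OF x] by (simp add: comb_def)
  also have "\<dots> = (\<Oplus>\<^bsub>N\<^esub>b\<in>B. h (coord x b \<odot>\<^bsub>F\<^esub> b))"
    using coord_closed x basis_closed finite_basis
    by (intro module_hom_finsum[OF module_axioms assms(1) h]) auto
  also have "\<dots> = (\<Oplus>\<^bsub>N\<^esub>b\<in>B. coord x b \<odot>\<^bsub>N\<^esub> h b)"
    using coord_closed x basis_closed module_homD(1,3)[OF h]
    by (intro N.M.finsum_cong') (auto simp: subset_iff)
  finally show ?thesis .
qed

text \<open>The image of \<open>x\<close> is a combination of the \<open>h b\<close> whose
  coefficients, the coordinates of \<open>x\<close>, lie in \<open>K\<close>. Applied to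
  \<open>I\<close> and \<open>J\<close>, this keeps the two parts of an element apart under a
  differential.\<close>

lemma hom_with_coords_in:
  assumes "free_basis R G B'" and h: "h \<in> module_hom R F G" and K: "ideal K R"
    and x: "x \<in> with_coords_in K"
  shows "h x \<in> free_basis.with_coords_in R G B' K"
proof -
  interpret G: free_basis R G B' by fact
  interpret K: ideal K R by fact
  interpret H: submodule "G.with_coords_in K" R G by (rule G.submodule_with_coords_in[OF K])
  have xF: "x \<in> carrier F" and xK: "\<And>b. b \<in> B \<Longrightarrow> coord x b \<in> K"
    using x by (auto simp: with_coords_in_def)
  have t: "coord x b \<odot>\<^bsub>G\<^esub> h b \<in> G.with_coords_in K" if "b \<in> B" for b
    using that xK[OF that] module_homD(1)[OF h, of b] basis_closed K.Icarr
    by (auto simp: G.with_coords_in_def G.coord_smult G.coord_closed K.I_r_closed)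
  \<comment> \<open>Stated for all subsets of \<open>B\<close> so that induction on finite sets
    applies.\<close>
  have "(\<Oplus>\<^bsub>G\<^esub>b\<in>A. coord x b \<odot>\<^bsub>G\<^esub> h b) \<in> G.with_coords_in K" if "A \<subseteq> B" for A
    using finite_subset[OF that finite_basis] that
  proof (induction A)
    case empty
    then show ?case using H.one_closed by simp
  next
    case (insert b A)
    then have *: "(\<lambda>b. coord x b \<odot>\<^bsub>G\<^esub> h b) \<in> A \<rightarrow> carrier G" "coord x b \<odot>\<^bsub>G\<^esub> h b \<in> carrier G"
      using t by (auto simp: G.with_coords_in_def subset_iff)
    have "(\<Oplus>\<^bsub>G\<^esub>b\<in>insert b A. coord x b \<odot>\<^bsub>G\<^esub> h b)
        = coord x b \<odot>\<^bsub>G\<^esub> h b \<oplus>\<^bsub>G\<^esub> (\<Oplus>\<^bsub>G\<^esub>b\<in>A. coord x b \<odot>\<^bsub>G\<^esub> h b)"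
      using insert(1,2) * by (intro G.M.finsum_insert)
    then show ?case
      using H.m_closed t insert by simp
  qed
  from this[of B] show ?thesis
    using hom_eq_sum[OF G.module_axioms h xF] by simp
qed

text \<open>Values prescribed on the basis extend linearly through the coordinates; this is what
  makes lifts along surjections possible.\<close>

lemma ex_hom:
  assumes "module R N" and k: "k \<in> B \<rightarrow> carrier N"
  shows "\<exists>h \<in> module_hom R F N. \<forall>b\<in>B. h b = k b"
proof -
  interpret N: module R N by fact
  let ?h = "\<lambda>x. \<Oplus>\<^bsub>N\<^esub>b\<in>B. coord x b \<odot>\<^bsub>N\<^esub> k b"
  have "?h \<in> module_hom R F N"
  proof (rule module_homI)
    fix x assume "x \<in> carrier F"
    then show "?h x \<in> carrier N" using k coord_closed by (intro N.M.finsum_closed) auto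
  next
    fix x y assume x: "x \<in> carrier F" and y: "y \<in> carrier F"
    have "?h (x \<oplus>\<^bsub>F\<^esub> y) = (\<Oplus>\<^bsub>N\<^esub>b\<in>B. (coord x b \<odot>\<^bsub>N\<^esub> k b) \<oplus>\<^bsub>N\<^esub> (coord y b \<odot>\<^bsub>N\<^esub> k b))"
      using x y k coord_closed
      by (intro N.M.finsum_cong') (auto simp: coord_add Pi_iff intro!: N.smult_l_distr)
    also have "\<dots> = ?h x \<oplus>\<^bsub>N\<^esub> ?h y"
      using x y k coord_closed by (intro N.M.finsum_addf) auto
    finally show "?h (x \<oplus>\<^bsub>F\<^esub> y) = ?h x \<oplus>\<^bsub>N\<^esub> ?h y" .
  next
    fix a x assume a: "a \<in> carrier R" and x: "x \<in> carrier F"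
    have "?h (a \<odot>\<^bsub>F\<^esub> x) = (\<Oplus>\<^bsub>N\<^esub>b\<in>B. a \<odot>\<^bsub>N\<^esub> (coord x b \<odot>\<^bsub>N\<^esub> k b))"
      using x a k coord_closed
      by (intro N.M.finsum_cong') (auto simp: coord_smult Pi_iff intro!: N.smult_assoc1)
    also have "\<dots> = a \<odot>\<^bsub>N\<^esub> ?h x"
      using x a k coord_closed finite_basis by (intro N.finsum_smult_ldistr[symmetric]) auto
    finally show "?h (a \<odot>\<^bsub>F\<^esub> x) = a \<odot>\<^bsub>N\<^esub> ?h x" .
  qed
  then show ?thesis
  proof (rule bexI[rotated], intro ballI)
    fix b assume b: "b \<in> B"
    have bF: "b \<in> carrier F" using b basis_closed by blast
    \<comment> \<open>The coordinate function of the basis element \<open>b\<close> itself.\<close>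
    let ?e = "\<lambda>b'. if b = b' then \<one> else \<zero>"
    have "comb ?e = (\<Oplus>\<^bsub>F\<^esub>b'\<in>B. if b = b' then b' else \<zero>\<^bsub>F\<^esub>)"
      unfolding comb_def using basis_closed by (intro M.finsum_cong') (auto simp: subset_iff)
    also have "\<dots> = b"
      using M.finsum_singleton[OF b finite_basis, of "\<lambda>x. x"] basis_closed by auto
    finally have "coord b b' = ?e b'" if "b' \<in> B" for b'
      using coord_comb[of ?e b'] that by auto
    then have "?h b = (\<Oplus>\<^bsub>N\<^esub>b'\<in>B. if b = b' then k b' else \<zero>\<^bsub>N\<^esub>)"
      using k by (intro N.M.finsum_cong') (auto simp: Pi_iff)
    also have "\<dots> = k b"
      using N.M.finsum_singleton[OF b finite_basis, of k] k by auto
    finally show "?h b = k b" .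
  qed
qed

text \<open>To lift \<open>f\<close> along \<open>g\<close>, choose preimages of the elements
  \<open>f (r b)\<close>, extend them linearly to \<open>h\<close> on \<open>F\<close>, and
  precompose with the inclusion \<open>i\<close> of \<open>P\<close>; since
  \<open>r (i x) = x\<close>, this lifts \<open>f\<close>.\<close>

lemma retract_imp_projective:
  fixes P :: "('a, 'd, 'l) module_scheme"
  assumes "module R P" and "module_retract R P F"
  shows "projective_module R P"
proof -
  have lift: "\<exists>h\<in>module_hom R P A. \<forall>x\<in>carrier P. g (h x) = f x"
    if "module R A" "module R D" and g: "g \<in> module_hom R A D" and surj: "g ` carrier A = carrier D"
      and f: "f \<in> module_hom R P D" for A D :: "('a, ('a + 'd) list) module" and g f
  proof -
    interpret A: module R A by fact
    interpret D: module R D by fact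
    obtain i r where i: "i \<in> module_hom R P F" and r: "r \<in> module_hom R F P"
      and ri: "\<And>x. x \<in> carrier P \<Longrightarrow> r (i x) = x"
      using assms(2) unfolding module_retract_def by blast
    have fr: "(\<lambda>x. f (r x)) \<in> module_hom R F D" by (rule module_hom_comp[OF r f])
    have "\<forall>b\<in>B. \<exists>a\<in>carrier A. g a = f (r b)"
    proof
      fix b assume "b \<in> B"
      then have "f (r b) \<in> g ` carrier A"
        using surj module_homD(1)[OF fr] basis_closed by auto
      then show "\<exists>a\<in>carrier A. g a = f (r b)" by fastforce
    qed
    then have "\<forall>b\<in>B. \<exists>a. a \<in> carrier A \<and> g a = f (r b)" by blast
    from bchoice[OF this] obtain k
      where k: "\<And>b. b \<in> B \<Longrightarrow> k b \<in> carrier A \<and> g (k b) = f (r b)" by blast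
    obtain h where h: "h \<in> module_hom R F A" and hk: "\<And>b. b \<in> B \<Longrightarrow> h b = k b"
      using ex_hom[OF \<open>module R A\<close>, of k] k by auto
    have gh: "(\<lambda>x. g (h x)) \<in> module_hom R F D" by (rule module_hom_comp[OF h g])
    have *: "g (h x) = f (r x)" if x: "x \<in> carrier F" for x
    proof -
      have "g (h x) = (\<Oplus>\<^bsub>D\<^esub>b\<in>B. coord x b \<odot>\<^bsub>D\<^esub> g (h b))"
        by (rule hom_eq_sum[OF \<open>module R D\<close> gh x])
      also have "\<dots> = (\<Oplus>\<^bsub>D\<^esub>b\<in>B. coord x b \<odot>\<^bsub>D\<^esub> f (r b))"
        using hk k coord_closed[OF x] module_homD(1)[OF fr] basis_closed
        by (intro D.M.finsum_cong') auto
      also have "\<dots> = f (r x)"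
        by (rule hom_eq_sum[OF \<open>module R D\<close> fr x, symmetric])
      finally show ?thesis .
    qed
    show ?thesis
      using module_hom_comp[OF i h] * module_homD(1)[OF i] ri
      by (intro bexI[of _ "\<lambda>x. h (i x)"]) auto
  qed
  show ?thesis
    unfolding projective_module_def
    by (intro conjI allI impI assms(1); elim conjE) (rule lift)
qed

end

lemma finite_rank_free_module_iff_ex_basis:
  "finite_rank_free_module R F \<longleftrightarrow> (\<exists>B. free_basis R F B)"
  by (simp add: finite_rank_free_module_def free_basis_def free_basis_axioms_def Ball_def)


section \<open>Nakayama's lemma\<close>

text \<open>A non-unit \<open>x\<close> lies in an ideal that is maximal among those containing
  \<open>x\<close> and omitting 1. Such an ideal is a maximal ideal, hence equals \<mm>.\<close>

lemma noetherian_local_ring_units: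
  assumes "noetherian_ring R" and "local_ring R \<mm>" and x: "x \<in> carrier R" "x \<notin> \<mm>"
  shows "x \<in> Units R"
proof (rule ccontr)
  assume nu: "x \<notin> Units R"
  interpret noetherian_ring R by fact
  interpret cring R using assms(2) by (simp add: local_ring_def)
  let ?C = "{J. ideal J R \<and> x \<in> J \<and> \<one>\<^bsub>R\<^esub> \<notin> J}"
  have "\<one>\<^bsub>R\<^esub> \<notin> PIdl\<^bsub>R\<^esub> x"
    using nu x by (auto simp: cgenideal_def Units_def m_comm)
  then have ne: "PIdl\<^bsub>R\<^esub> x \<in> ?C"
    using x cgenideal_ideal cgenideal_self by auto
  have "\<exists>U\<in>?C. \<forall>J\<in>C. J \<subseteq> U" if "subset.chain ?C C" for C
  proof (cases "C = {}")
    case True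
    then show ?thesis using ne by blast
  next
    case False
    have sub: "C \<subseteq> ?C" using that by (simp add: pred_on.chain_def)
    have "subset.chain {I. ideal I R} C"
      using that by (auto simp: pred_on.chain_def)
    \<comment> \<open>In a noetherian ring a non-empty chain of ideals contains its union, which is
      then the upper bound that Zorn's lemma asks for.\<close>
    then have "\<Union>C \<in> C" using ideal_chain_is_trivial False by blast
    then show ?thesis
      using sub by (intro bexI[of _ "\<Union>C"]) auto
  qed
  then have "\<exists>P\<in>?C. \<forall>J\<in>?C. P \<subseteq> J \<longrightarrow> J = P" by (rule subset_Zorn)
  then obtain P where P: "P \<in> ?C" and max: "\<And>J. J \<in> ?C \<Longrightarrow> P \<subseteq> J \<Longrightarrow> J = P"
    by (elim bexE) blast
  have "maximalideal P R"
  proof (rule maximalidealI)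
    show "ideal P R" using P by blast
    show "carrier R \<noteq> P" using P by blast
  next
    fix J assume J: "ideal J R" "P \<subseteq> J" "J \<subseteq> carrier R"
    show "J = P \<or> J = carrier R"
      using max[of J] J P ideal.one_imp_carrier[OF J(1)] by blast
  qed
  then have "P = \<mm>" using assms(2) by (simp add: local_ring_def)
  then show False using P x by blast
qed

text \<open>Locality in the form in which it is used: everything outside \<mm> is invertible. This
  serves both Nakayama's lemma and the normalisation of a coordinate.\<close>

locale local_cring = cring R + ideal \<mm> R for R :: "('a, 'm) ring_scheme" (structure) and \<mm> +
  assumes one_notin: "\<one> \<notin> \<mm>" and unitI: "x \<in> carrier R \<Longrightarrow> x \<notin> \<mm> \<Longrightarrow> x \<in> Units R"
begin

text \<open>Gaussian elimination: each pivot \<open>\<one> \<ominus> c s s\<close> is a unit, so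
  \<open>a s\<close> can be solved for and substituted into the other equations, whose new
  coefficients again lie in \<mm>. The induction removes one member of the family at a time.\<close>

lemma nakayama:
  assumes "module R N" and "finite S" and "a \<in> S \<rightarrow> carrier N"
    and "\<And>s. s \<in> S \<Longrightarrow> c s \<in> S \<rightarrow> \<mm>"
    and "\<And>s. s \<in> S \<Longrightarrow> a s = (\<Oplus>\<^bsub>N\<^esub>t\<in>S. c s t \<odot>\<^bsub>N\<^esub> a t)"
    and "q \<in> S"
  shows "a q = \<zero>\<^bsub>N\<^esub>"
  using assms(2-)
proof (induction S arbitrary: c q)
  case empty
  then show ?case by blast
next
  case (insert s S)
  interpret N: module R N by fact
  have a: "a s \<in> carrier N" "a \<in> S \<rightarrow> carrier N" and aS: "\<And>t. t \<in> S \<Longrightarrow> a t \<in> carrier N"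
    using insert.prems(1) by auto
  have c: "c t t' \<in> \<mm>" "c t t' \<in> carrier R" if "t \<in> insert s S" "t' \<in> insert s S" for t t'
    using insert.prems(2) that Icarr by blast+
  note cR = c(2)
  \<comment> \<open>The right-hand side of the equation for \<open>t\<close> without its term in
    \<open>a s\<close>.\<close>
  define T where "T t = (\<Oplus>\<^bsub>N\<^esub>t'\<in>S. c t t' \<odot>\<^bsub>N\<^esub> a t')" for t
  have T: "T t \<in> carrier N" if "t \<in> insert s S" for t
    unfolding T_def using that a c by (intro N.M.finsum_closed) auto
  have split: "a t = c t s \<odot>\<^bsub>N\<^esub> a s \<oplus>\<^bsub>N\<^esub> T t" if "t \<in> insert s S" for t
    using insert.prems(3)[OF that] insert.hyps a c that unfolding T_def
    by (subst (asm) N.M.finsum_insert) auto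
  define u where "u = inv (\<one> \<ominus> c s s)"
  have css: "c s s \<in> \<mm>" "c s s \<in> carrier R" using c by auto
  have "\<one> \<ominus> c s s \<notin> \<mm>"
  proof
    assume "\<one> \<ominus> c s s \<in> \<mm>"
    then have "(\<one> \<ominus> c s s) \<oplus> c s s \<in> \<mm>" using css a_closed by blast
    moreover have "(\<one> \<ominus> c s s) \<oplus> c s s = \<one>" using css by algebra
    ultimately show False using one_notin by simp
  qed
  then have "\<one> \<ominus> c s s \<in> Units R" using unitI css by simp
  then have u: "u \<in> carrier R" "u \<otimes> (\<one> \<ominus> c s s) = \<one>"
    unfolding u_def by simp_all
  \<comment> \<open>The equation for \<open>s\<close> with its term in \<open>a s\<close> moved to
    the left; multiplying by \<open>u\<close> then expresses \<open>a s\<close> through the family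
    on \<open>S\<close>.\<close>
  have "(\<one> \<ominus> c s s) \<odot>\<^bsub>N\<^esub> a s = a s \<ominus>\<^bsub>N\<^esub> c s s \<odot>\<^bsub>N\<^esub> a s"
    using css a by (simp add: a_minus_def N.smult_l_distr N.smult_l_minus)
  also have "\<dots> = (c s s \<odot>\<^bsub>N\<^esub> a s \<oplus>\<^bsub>N\<^esub> T s) \<ominus>\<^bsub>N\<^esub> c s s \<odot>\<^bsub>N\<^esub> a s"
    using split[of s] by simp
  also have "\<dots> = T s"
    using css a T[of s] by (simp add: a_minus_def N.M.a_assoc N.M.a_lcomm N.M.r_neg)
  finally have "u \<odot>\<^bsub>N\<^esub> T s = a s"
    using u css a N.smult_assoc1[of u "\<one> \<ominus> c s s" "a s"] by simp
  moreover have "u \<odot>\<^bsub>N\<^esub> T s = (\<Oplus>\<^bsub>N\<^esub>t\<in>S. u \<odot>\<^bsub>N\<^esub> (c s t \<odot>\<^bsub>N\<^esub> a t))"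
    unfolding T_def using u cR aS insert.hyps by (intro N.finsum_smult_ldistr) auto
  ultimately have as: "a s = (\<Oplus>\<^bsub>N\<^esub>t\<in>S. u \<odot>\<^bsub>N\<^esub> (c s t \<odot>\<^bsub>N\<^esub> a t))" by simp
  have zS: "a t = \<zero>\<^bsub>N\<^esub>" if t: "t \<in> S" for t
  \<comment> \<open>These are the coefficients after the expression for \<open>a s\<close> has been
    substituted into the equation for \<open>t\<close>.\<close>
  proof (rule insert.IH[OF a(2), of "\<lambda>t t'. c t s \<otimes> (u \<otimes> c s t') \<oplus> c t t'" t, OF _ _ t])
    fix t assume t: "t \<in> S"
    show "(\<lambda>t'. c t s \<otimes> (u \<otimes> c s t') \<oplus> c t t') \<in> S \<rightarrow> \<mm>"
      using t c u by (auto intro!: a_closed I_l_closed)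
    have "c t s \<odot>\<^bsub>N\<^esub> a s = (\<Oplus>\<^bsub>N\<^esub>t'\<in>S. c t s \<odot>\<^bsub>N\<^esub> (u \<odot>\<^bsub>N\<^esub> (c s t' \<odot>\<^bsub>N\<^esub> a t')))"
      unfolding as using t u cR aS insert.hyps
      by (intro N.finsum_smult_ldistr) (auto intro!: N.smult_closed)
    then have "a t = (\<Oplus>\<^bsub>N\<^esub>t'\<in>S. c t s \<odot>\<^bsub>N\<^esub> (u \<odot>\<^bsub>N\<^esub> (c s t' \<odot>\<^bsub>N\<^esub> a t'))) \<oplus>\<^bsub>N\<^esub> T t"
      using split[of t] t by simp
    also have "\<dots> = (\<Oplus>\<^bsub>N\<^esub>t'\<in>S. c t s \<odot>\<^bsub>N\<^esub> (u \<odot>\<^bsub>N\<^esub> (c s t' \<odot>\<^bsub>N\<^esub> a t')) \<oplus>\<^bsub>N\<^esub> c t t' \<odot>\<^bsub>N\<^esub> a t')"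
      unfolding T_def using t u cR aS a by (intro N.M.finsum_addf[symmetric]) auto
    also have "\<dots> = (\<Oplus>\<^bsub>N\<^esub>t'\<in>S. (c t s \<otimes> (u \<otimes> c s t') \<oplus> c t t') \<odot>\<^bsub>N\<^esub> a t')"
      using t u cR aS by (intro N.M.finsum_cong') (auto simp: N.smult_l_distr N.smult_assoc1)
    finally show "a t = \<dots>" .
  qed
  have "a s = \<zero>\<^bsub>N\<^esub>"
  proof -
    have "a s = (\<Oplus>\<^bsub>N\<^esub>t\<in>S. \<zero>\<^bsub>N\<^esub>)"
      unfolding as using zS u cR by (intro N.M.finsum_cong') auto
    then show ?thesis by simp
  qed
  then show ?case using zS insert.prems(4) by blast
qed

text \<open>
  If every basis element \<open>b\<close> had \<open>h (r (d b)) = d x\<close> only for \<open>x \<in> \<mm> F\<close>, then \<open>h \<circ> r\<close> would map the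
  image of \<open>d\<close> onto a module equal to \<open>\<mm>\<close> times itself.
\<close>
lemma ex_preimage_notin:
  assumes "free_basis R F B" and "module R N" and "module R C"
    and d: "d \<in> module_hom R F N"
    and h: "h \<in> module_hom R C (N\<lparr>carrier := d ` carrier F\<rparr>)"
    and r: "r \<in> module_hom R (N\<lparr>carrier := d ` carrier F\<rparr>) C"
    and rh: "\<And>x. x \<in> carrier C \<Longrightarrow> r (h x) = x"
    and C: "carrier C \<noteq> {\<zero>\<^bsub>C\<^esub>}"
  obtains y where "y \<in> carrier F" and "y \<notin> free_basis.with_coords_in R F B \<mm>"
    and "d y \<in> h ` carrier C"
proof (rule ccontr)
  note obtain_that = that
  interpret F: free_basis R F B by fact
  assume "\<not> thesis"
  then have no: "y \<in> F.with_coords_in \<mm>" if "y \<in> carrier F" "d y \<in> h ` carrier C" for y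
    using that obtain_that by blast
  interpret N: module R N by fact
  interpret C: module R C by fact
  have rd: "(\<lambda>x. r (d x)) \<in> module_hom R F C"
    using module_homD[OF d] module_homD[OF r] by (intro module_homI) auto
  have "\<exists>x. x \<in> F.with_coords_in \<mm> \<and> d x = h (r (d b))" if "b \<in> B" for b
  proof -
    have "r (d b) \<in> carrier C" using that F.basis_closed module_homD(1)[OF rd] by blast
    moreover from this have "h (r (d b)) \<in> d ` carrier F" using module_homD(1)[OF h] by simp
    ultimately show ?thesis using no by (metis imageE image_eqI)
  qed
  then have "\<forall>b\<in>B. \<exists>x. x \<in> F.with_coords_in \<mm> \<and> d x = h (r (d b))" by blast
  from bchoice[OF this] obtain x where x: "\<And>b. b \<in> B \<Longrightarrow> x b \<in> F.with_coords_in \<mm>"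
    and dx: "\<And>b. b \<in> B \<Longrightarrow> d (x b) = h (r (d b))" by blast
  have rdB: "(\<lambda>b. r (d b)) \<in> B \<rightarrow> carrier C"
    using F.basis_closed module_homD(1)[OF rd] by blast
  have "r (d b) = \<zero>\<^bsub>C\<^esub>" if b: "b \<in> B" for b
  \<comment> \<open>Since \<open>r (d b) = r (d (x b))\<close>, the coordinates of
    \<open>x b\<close>, which lie in \<mm>, express \<open>r (d b)\<close> through the whole family
    of these elements.\<close>
  proof (rule nakayama[OF \<open>module R C\<close> F.finite_basis rdB, of "\<lambda>b. F.coord (x b)" b, OF _ _ b])
    fix b assume b: "b \<in> B"
    show "F.coord (x b) \<in> B \<rightarrow> \<mm>" using x[OF b] by (auto simp: F.with_coords_in_def)
    have "r (d b) = r (d (x b))" using dx[OF b] rh rdB b by (simp add: Pi_iff)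
    also have "\<dots> = (\<Oplus>\<^bsub>C\<^esub>b'\<in>B. F.coord (x b) b' \<odot>\<^bsub>C\<^esub> r (d b'))"
      using x[OF b] by (intro F.hom_eq_sum[OF \<open>module R C\<close> rd]) (auto simp: F.with_coords_in_def)
    finally show "r (d b) = \<dots>" .
  qed
  then have z: "r (d y) = \<zero>\<^bsub>C\<^esub>" if "y \<in> carrier F" for y
  proof -
    assume 0: "\<And>b. b \<in> B \<Longrightarrow> r (d b) = \<zero>\<^bsub>C\<^esub>"
    have "r (d y) = (\<Oplus>\<^bsub>C\<^esub>b\<in>B. F.coord y b \<odot>\<^bsub>C\<^esub> r (d b))"
      by (rule F.hom_eq_sum[OF \<open>module R C\<close> rd that])
    also have "\<dots> = (\<Oplus>\<^bsub>C\<^esub>b\<in>B. \<zero>\<^bsub>C\<^esub>)"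
      using 0 F.coord_closed[OF that] by (intro C.M.finsum_cong') auto
    finally show ?thesis by simp
  qed
  have "x = \<zero>\<^bsub>C\<^esub>" if "x \<in> carrier C" for x
  proof -
    have "h x \<in> d ` carrier F" using module_homD(1)[OF h that] by simp
    then show ?thesis using z rh[OF that] by auto
  qed
  then show False using C C.M.zero_closed by blast
qed

text \<open>Some coordinate of \<open>y\<close> lies outside \<mm>, hence is a unit; the
  corresponding coordinate function divided by this unit is \<phi>.\<close>

lemma ex_functional:
  assumes "free_basis R F B" and y: "y \<in> carrier F" "y \<notin> free_basis.with_coords_in R F B \<mm>"
  obtains \<phi> where "\<phi> \<in> module_hom R F (ideal_module R (carrier R))" and "\<phi> y = \<one>"
    and "\<And>x. x \<in> free_basis.with_coords_in R F B \<mm> \<Longrightarrow> \<phi> x \<in> \<mm>"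
proof -
  interpret F: free_basis R F B by fact
  obtain b where b: "b \<in> B" "F.coord y b \<notin> \<mm>"
    using y by (auto simp: F.with_coords_in_def)
  then have "F.coord y b \<in> Units R" using unitI F.coord_closed y by blast
  then have u: "inv F.coord y b \<in> carrier R" "inv F.coord y b \<otimes> F.coord y b = \<one>" by simp_all
  let ?\<phi> = "\<lambda>x. inv F.coord y b \<otimes> F.coord x b"
  have "?\<phi> \<in> module_hom R F (ideal_module R (carrier R))"
    using b u by (intro module_homI)
      (auto simp: F.coord_closed F.coord_add F.coord_smult r_distr m_lcomm)
  moreover have "?\<phi> x \<in> \<mm>" if "x \<in> F.with_coords_in \<mm>" for x
    using that b u I_l_closed by (auto simp: F.with_coords_in_def)
  ultimately show ?thesis using that[of ?\<phi>] u by blast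
qed

end


section \<open>Splitting along a decomposition of the maximal ideal\<close>

text \<open>The component in \<open>I\<close> of an element of \<open>I + J\<close>, unambiguous
  when \<open>I\<close> and \<open>J\<close> meet in zero. The component in \<open>J\<close> is
  obtained as \<open>ideal_proj R J I\<close>.\<close>

definition ideal_proj :: "('a, 'm) ring_scheme \<Rightarrow> 'a set \<Rightarrow> 'a set \<Rightarrow> 'a \<Rightarrow> 'a"
  where "ideal_proj R I J x = (THE i. i \<in> I \<and> (\<exists>j\<in>J. x = i \<oplus>\<^bsub>R\<^esub> j))"

text \<open>The assumptions are symmetric in \<open>I\<close> and \<open>J\<close>; the
  interpretations named \<open>swap\<close> use this to obtain each fact for the other ideal as
  well.\<close>

locale ideal_pair = cring R + I: ideal I R + J: ideal J R
  for R :: "('a, 'm) ring_scheme" (structure) and I J +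
  assumes inter_zero: "I \<inter> J = {\<zero>}"
begin

text \<open>The product lies in both ideals. This is why each of them, viewed as a module, is killed
  by the other.\<close>

lemma mult_zero: "i \<in> I \<Longrightarrow> j \<in> J \<Longrightarrow> i \<otimes> j = \<zero>"
  using I.I_r_closed[of i j] J.I_l_closed[of j i] inter_zero I.Icarr J.Icarr by blast

lemma sum_eq_zero:
  assumes "i \<in> I" "j \<in> J" "i \<oplus> j = \<zero>"
  shows "i = \<zero> \<and> j = \<zero>"
proof -
  have "i = \<ominus> j" using assms I.Icarr J.Icarr by (metis minus_equality)
  then have "i \<in> J" using assms J.a_inv_closed by simp
  then have "i = \<zero>" using assms inter_zero by blast
  then show ?thesis using assms J.Icarr by simp
qed

lemma ideal_proj_eq:
  assumes "i \<in> I" "j \<in> J"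
  shows "ideal_proj R I J (i \<oplus> j) = i"
  unfolding ideal_proj_def
proof (rule the_equality)
  show "i \<in> I \<and> (\<exists>j'\<in>J. i \<oplus> j = i \<oplus> j')" using assms by blast
next
  fix i' assume "i' \<in> I \<and> (\<exists>j'\<in>J. i \<oplus> j = i' \<oplus> j')"
  then obtain j' where i': "i' \<in> I" and j': "j' \<in> J" and eq: "i \<oplus> j = i' \<oplus> j'" by blast
  have cs: "i \<in> carrier R" "i' \<in> carrier R" "j \<in> carrier R" "j' \<in> carrier R"
    using assms i' j' I.Icarr J.Icarr by auto
  have "(i' \<ominus> i) \<oplus> (j' \<ominus> j) = (i' \<oplus> j') \<ominus> (i \<oplus> j)" using cs by algebra
  also have "\<dots> = \<zero>" using eq cs by algebra
  finally have "i' \<ominus> i = \<zero>"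
    using sum_eq_zero[of "i' \<ominus> i" "j' \<ominus> j"] assms i' j'
    by (simp add: a_minus_def I.a_inv_closed J.a_inv_closed I.a_closed J.a_closed)
  then show "i' = i" using cs by simp
qed

lemma ideal_proj_swap_eq:
  assumes "i \<in> I" "j \<in> J"
  shows "ideal_proj R J I (i \<oplus> j) = j"
proof -
  interpret swap: ideal_pair R J I
    using inter_zero by unfold_locales auto
  show ?thesis
    using swap.ideal_proj_eq[of j i] assms a_comm[of i j] I.Icarr J.Icarr by simp
qed

lemma sumE:
  assumes "x \<in> I <+>\<^bsub>R\<^esub> J"
  obtains i j where "i \<in> I" "j \<in> J" "x = i \<oplus> j"
  using assms by (auto simp: set_add_def')

lemma ideal_proj_decomp:
  "x \<in> I <+>\<^bsub>R\<^esub> J \<Longrightarrow> x = ideal_proj R I J x \<oplus> ideal_proj R J I x"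
  by (elim sumE) (simp add: ideal_proj_eq ideal_proj_swap_eq)

lemma ideal_proj_id: "i \<in> I \<Longrightarrow> ideal_proj R I J i = i"
  using ideal_proj_eq[of i \<zero>] I.Icarr by simp

lemma ideal_proj_hom:
  "ideal_proj R I J \<in> module_hom R (ideal_module R (I <+>\<^bsub>R\<^esub> J)) (ideal_module R I)"
proof (rule module_homI; simp)
  fix x assume "x \<in> I <+>\<^bsub>R\<^esub> J"
  then show "ideal_proj R I J x \<in> I" by (elim sumE) (simp add: ideal_proj_eq)
next
  fix x y assume "x \<in> I <+>\<^bsub>R\<^esub> J" "y \<in> I <+>\<^bsub>R\<^esub> J"
  then obtain i j i' j' where ij: "i \<in> I" "j \<in> J" "i' \<in> I" "j' \<in> J"
    and x: "x = i \<oplus> j" "y = i' \<oplus> j'"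
    by (elim sumE) blast
  have cs: "i \<in> carrier R" "i' \<in> carrier R" "j \<in> carrier R" "j' \<in> carrier R"
    using ij I.Icarr J.Icarr by auto
  have "x \<oplus> y = (i \<oplus> i') \<oplus> (j \<oplus> j')" unfolding x using cs by algebra
  then show "ideal_proj R I J (x \<oplus> y) = ideal_proj R I J x \<oplus> ideal_proj R I J y"
    using ideal_proj_eq ij x I.a_closed J.a_closed by simp
next
  fix a x assume a: "a \<in> carrier R" and "x \<in> I <+>\<^bsub>R\<^esub> J"
  then obtain i j where ij: "i \<in> I" "j \<in> J" and x: "x = i \<oplus> j" by (elim sumE)
  have "a \<otimes> x = a \<otimes> i \<oplus> a \<otimes> j" unfolding x using a ij I.Icarr J.Icarr by (simp add: r_distr)
  then show "ideal_proj R I J (a \<otimes> x) = a \<otimes> ideal_proj R I J x"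
    using ideal_proj_eq ij x a I.I_l_closed J.I_l_closed by simp
qed

text \<open>Split an element of \<open>I + J\<close> into its components, embed the one in
  \<open>I\<close> into \<open>K\<close> and the one in \<open>J\<close> into \<open>L\<close>, and
  go back by adding the two retractions.\<close>

lemma retract_sum:
  assumes "module R K" and "module R L" and "module_retract R (ideal_module R I) K"
    and "module_retract R (ideal_module R J) L"
  shows "module_retract R (ideal_module R (I <+>\<^bsub>R\<^esub> J)) (direct_sum K L)"
proof -
  interpret K: module R K by fact
  interpret L: module R L by fact
  interpret swap: ideal_pair R J I
    using inter_zero by unfold_locales auto
  have sw: "J <+>\<^bsub>R\<^esub> I = I <+>\<^bsub>R\<^esub> J"
    using set_add_comm I.a_subset J.a_subset by blast
  obtain h r where h: "h \<in> module_hom R (ideal_module R I) K"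
    and r: "r \<in> module_hom R K (ideal_module R I)" and rh: "\<And>i. i \<in> I \<Longrightarrow> r (h i) = i"
    using assms(3) by (auto simp: module_retract_def)
  obtain h' r' where h': "h' \<in> module_hom R (ideal_module R J) L"
    and r': "r' \<in> module_hom R L (ideal_module R J)" and rh': "\<And>j. j \<in> J \<Longrightarrow> r' (h' j) = j"
    using assms(4) by (auto simp: module_retract_def)
  note pI = module_hom_comp[OF ideal_proj_hom h]
  note pJ = module_hom_comp[OF swap.ideal_proj_hom[unfolded sw] h']
  let ?H = "\<lambda>x. (h (ideal_proj R I J x), h' (ideal_proj R J I x))"
  let ?R = "\<lambda>(u, v). r u \<oplus> r' v"
  have "?H \<in> module_hom R (ideal_module R (I <+>\<^bsub>R\<^esub> J)) (direct_sum K L)"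
    using module_homD[OF pI] module_homD[OF pJ] by (intro module_homI) simp_all
  moreover have "?R \<in> module_hom R (direct_sum K L) (ideal_module R (I <+>\<^bsub>R\<^esub> J))"
  proof (rule module_homI; clarsimp)
    fix u v assume "u \<in> carrier K" "v \<in> carrier L"
    then have "r u \<in> I" "r' v \<in> J" using module_homD(1)[OF r] module_homD(1)[OF r'] by auto
    then show "r u \<oplus> r' v \<in> I <+>\<^bsub>R\<^esub> J" by (auto simp: set_add_def')
  next
    fix u v u' v' assume uv: "u \<in> carrier K" "v \<in> carrier L" "u' \<in> carrier K" "v' \<in> carrier L"
    then have "r u \<in> carrier R" "r' v \<in> carrier R" "r u' \<in> carrier R" "r' v' \<in> carrier R"
      using module_homD(1)[OF r] module_homD(1)[OF r'] I.Icarr J.Icarr by auto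
    then show "r (u \<oplus>\<^bsub>K\<^esub> u') \<oplus> r' (v \<oplus>\<^bsub>L\<^esub> v') = r u \<oplus> r' v \<oplus> (r u' \<oplus> r' v')"
      using uv module_homD(2)[OF r] module_homD(2)[OF r'] by (simp add: a_ac)
  next
    fix a u v assume uv: "a \<in> carrier R" "u \<in> carrier K" "v \<in> carrier L"
    then have "r u \<in> carrier R" "r' v \<in> carrier R"
      using module_homD(1)[OF r] module_homD(1)[OF r'] I.Icarr J.Icarr by auto
    then show "r (a \<odot>\<^bsub>K\<^esub> u) \<oplus> r' (a \<odot>\<^bsub>L\<^esub> v) = a \<otimes> (r u \<oplus> r' v)"
      using uv module_homD(3)[OF r] module_homD(3)[OF r'] by (simp add: r_distr)
  qed
  moreover have "?R (?H x) = x" if "x \<in> I <+>\<^bsub>R\<^esub> J" for x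
    using module_homD(1)[OF ideal_proj_hom, of x] module_homD(1)[OF swap.ideal_proj_hom, of x]
      that ideal_proj_decomp[OF that] rh rh' sw by simp
  ultimately show ?thesis
    unfolding module_retract_def by (intro bexI[of _ ?H] bexI[of _ ?R]) auto
qed

end

section \<open>Kernels contained in \<mm> times a free module\<close>

locale decomposed_local_cring = local_cring R \<mm> + ideal_pair R I J
  for R :: "('a, 'm) ring_scheme" (structure) and \<mm> I J +
  assumes sum_eq: "I <+>\<^bsub>R\<^esub> J = \<mm>"
begin

text \<open>Pick \<open>y\<close> outside \<mm> \<open>F\<close> with \<open>d y\<close> in the copy
  of \<open>C\<close>. As \<open>I\<close> kills \<open>C\<close>, the multiples of \<open>y\<close>
  by \<open>I\<close> lie in the kernel, which gives the inclusion of \<open>I\<close>. A functional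
  with value 1 at \<open>y\<close> sends the kernel into \<mm> by \<open>min\<close>; followed by
  the projection to \<open>I\<close>, it is the retraction.\<close>

lemma retract_kernel:
  assumes "free_basis R F B" and "module R N" and d: "d \<in> module_hom R F N"
    and min: "a_kernel F N d \<subseteq> free_basis.with_coords_in R F B \<mm>"
    and C: "module R C" "module_retract R C (N\<lparr>carrier := d ` carrier F\<rparr>)" "carrier C \<noteq> {\<zero>\<^bsub>C\<^esub>}"
    and kill: "\<And>i x. i \<in> I \<Longrightarrow> x \<in> carrier C \<Longrightarrow> i \<odot>\<^bsub>C\<^esub> x = \<zero>\<^bsub>C\<^esub>"
  shows "module_retract R (ideal_module R I) (F\<lparr>carrier := a_kernel F N d\<rparr>)"
proof -
  interpret F: free_basis R F B by fact
  interpret N: module R N by fact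
  let ?N = "N\<lparr>carrier := d ` carrier F\<rparr>"
  have mN: "module R ?N"
    using submodule.submodule_is_module[OF submodule_image[OF F.module_axioms assms(2) d] assms(2)] .
  obtain h r where h: "h \<in> module_hom R C ?N" and r: "r \<in> module_hom R ?N C"
    and rh: "\<And>x. x \<in> carrier C \<Longrightarrow> r (h x) = x"
    using C(2) by (auto simp: module_retract_def)
  obtain y where y: "y \<in> carrier F" "y \<notin> F.with_coords_in \<mm>" and dy: "d y \<in> h ` carrier C"
    using ex_preimage_notin[OF assms(1,2) C(1) d h r rh C(3)] .
  obtain \<phi> where \<phi>: "\<phi> \<in> module_hom R F (ideal_module R (carrier R))" and \<phi>y: "\<phi> y = \<one>"
    and \<phi>m: "\<And>x. x \<in> F.with_coords_in \<mm> \<Longrightarrow> \<phi> x \<in> \<mm>"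
    by (rule ex_functional[OF assms(1) y]) blast
  have iy: "i \<odot>\<^bsub>F\<^esub> y \<in> a_kernel F N d" if i: "i \<in> I" for i
  proof -
    obtain c where c: "c \<in> carrier C" "d y = h c" using dy by blast
    have "d (i \<odot>\<^bsub>F\<^esub> y) = i \<odot>\<^bsub>N\<^esub> h c"
      using module_homD(3)[OF d] y i I.Icarr c by simp
    also have "\<dots> = h (i \<odot>\<^bsub>C\<^esub> c)"
      using module_homD(3)[OF h] c i I.Icarr by simp
    also have "\<dots> = \<zero>\<^bsub>N\<^esub>"
      using kill[OF i c(1)] module_hom_zero[OF C(1) mN h] by simp
    finally show ?thesis using i y I.Icarr by (simp add: a_kernel_def')
  qed
  let ?K = "F\<lparr>carrier := a_kernel F N d\<rparr>"
  have kF: "x \<in> carrier F" if "x \<in> a_kernel F N d" for x using that by (simp add: a_kernel_def')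
  have 1: "(\<lambda>i. i \<odot>\<^bsub>F\<^esub> y) \<in> module_hom R (ideal_module R I) ?K"
    using iy y I.Icarr by (intro module_homI) (auto simp: F.smult_l_distr F.smult_assoc1)
  have "\<phi> \<in> module_hom R ?K (ideal_module R (I <+>\<^bsub>R\<^esub> J))"
    using module_homD[OF \<phi>] kF \<phi>m min sum_eq by (intro module_homI) auto
  note 2 = module_hom_comp[OF this ideal_proj_hom]
  have "ideal_proj R I J (\<phi> (i \<odot>\<^bsub>F\<^esub> y)) = i" if "i \<in> I" for i
    using that module_homD(3)[OF \<phi>, of i y] y \<phi>y I.Icarr ideal_proj_id by simp
  then show ?thesis
    unfolding module_retract_def using 1 2
    by (intro bexI[OF bexI[OF _ 2] 1]) simp
qed

text \<open>
  If \<open>d u = 0\<close> and \<open>u = u\<^sub>I + u\<^sub>J\<close>, then \<open>d u\<^sub>I = - d u\<^sub>J\<close> has its coordinates in \<open>I \<inter> J\<close>.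
\<close>
lemma kernel_part:
  assumes "free_basis R F B" and "free_basis R G B'" and d: "d \<in> module_hom R F G"
  defines "K \<equiv> a_kernel F G d"
  assumes min: "K \<subseteq> free_basis.with_coords_in R F B \<mm>"
  defines "C \<equiv> K \<inter> free_basis.with_coords_in R F B I"
  shows "submodule C R F"
    and "module_retract R (F\<lparr>carrier := C\<rparr>) (F\<lparr>carrier := K\<rparr>)"
    and "\<And>j x. j \<in> J \<Longrightarrow> x \<in> C \<Longrightarrow> j \<odot>\<^bsub>F\<^esub> x = \<zero>\<^bsub>F\<^esub>"
    and "\<And>x. x \<in> K \<Longrightarrow> \<exists>u\<in>C. \<exists>v\<in>K \<inter> free_basis.with_coords_in R F B J. x = u \<oplus>\<^bsub>F\<^esub> v"
proof -
  interpret F: free_basis R F B by fact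
  interpret G: free_basis R G B' by fact
  interpret swap: ideal_pair R J I
    using inter_zero by unfold_locales auto
  have sw: "J <+>\<^bsub>R\<^esub> I = \<mm>"
    using set_add_comm I.a_subset J.a_subset sum_eq by metis
  interpret FI: submodule "F.with_coords_in I" R F by (rule F.submodule_with_coords_in) (rule I.is_ideal)
  interpret FK: submodule K R F
    unfolding K_def by (rule submodule_kernel[OF F.module_axioms G.module_axioms d])
  show sub: "submodule C R F"
    unfolding C_def
    using F.submoduleE[OF FI.submodule_axioms] F.submoduleE[OF FK.submodule_axioms]
      FI.one_closed FK.one_closed
    by (intro F.submoduleI) auto
  \<comment> \<open>The parts \<open>u\<^sub>I\<close> and \<open>u\<^sub>J\<close>, formed
    coordinate by coordinate; \<open>?p\<close> is going to be the retraction of \<open>K\<close>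
    onto \<open>C\<close>.\<close>
  let ?p = "\<lambda>x. F.comb (\<lambda>b. ideal_proj R I J (F.coord x b))"
  let ?q = "\<lambda>x. F.comb (\<lambda>b. ideal_proj R J I (F.coord x b))"
  have KF: "K \<subseteq> carrier F" by (auto simp: K_def a_kernel_def')
  have cm: "F.coord x b \<in> \<mm>" if "x \<in> K" "b \<in> B" for x b
    using that min by (auto simp: F.with_coords_in_def)
  note pI = module_homD[OF ideal_proj_hom[unfolded sum_eq], simplified]
  note pJ = module_homD[OF swap.ideal_proj_hom[unfolded sw], simplified]
  have p: "(\<lambda>b. ideal_proj R I J (F.coord x b)) \<in> B \<rightarrow> carrier R"
    and q: "(\<lambda>b. ideal_proj R J I (F.coord x b)) \<in> B \<rightarrow> carrier R" if "x \<in> K" for x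
    using cm[OF that] pI(1) pJ(1) I.Icarr J.Icarr by auto
  have pw: "?p x \<in> F.with_coords_in I" and qw: "?q x \<in> F.with_coords_in J" if "x \<in> K" for x
    using cm[OF that] pI(1) pJ(1) p[OF that] q[OF that]
    by (auto simp: F.with_coords_in_def F.comb_closed F.coord_comb)
  have pq: "x = ?p x \<oplus>\<^bsub>F\<^esub> ?q x" if x: "x \<in> K" for x
  proof -
    have "?p x \<oplus>\<^bsub>F\<^esub> ?q x = F.comb (\<lambda>b. ideal_proj R I J (F.coord x b) \<oplus> ideal_proj R J I (F.coord x b))"
      using p[OF x] q[OF x] by (rule F.comb_add[symmetric])
    also have "\<dots> = F.comb (F.coord x)"
      using ideal_proj_decomp[unfolded sum_eq] cm[OF x] Icarr by (intro F.comb_cong) auto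
    also have "\<dots> = x" using x KF by (intro F.comb_coord) auto
    finally show ?thesis by simp
  qed
  have pqK: "?p x \<in> K \<and> ?q x \<in> K" if x: "x \<in> K" for x
  proof -
    have c: "?p x \<in> carrier F" "?q x \<in> carrier F" using pw[OF x] qw[OF x] by (auto simp: F.with_coords_in_def)
    have dp: "d (?p x) \<in> G.with_coords_in I" "d (?q x) \<in> G.with_coords_in J"
      using F.hom_with_coords_in[OF assms(2) d I.is_ideal pw[OF x]]
        F.hom_with_coords_in[OF assms(2) d J.is_ideal qw[OF x]] by auto
    have cG: "d (?p x) \<in> carrier G" "d (?q x) \<in> carrier G"
      using dp by (auto simp: G.with_coords_in_def)
    have "d x = \<zero>\<^bsub>G\<^esub>" using x by (simp add: K_def a_kernel_def')
    then have "d (?p x) \<oplus>\<^bsub>G\<^esub> d (?q x) = \<zero>\<^bsub>G\<^esub>"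
      using module_homD(2)[OF d c] pq[OF x] by simp
    then have "G.coord (d (?p x)) b \<oplus> G.coord (d (?q x)) b = \<zero>" if "b \<in> B'" for b
      using G.coord_add[OF cG that] G.coord_zero[OF that] by simp
    \<comment> \<open>In each coordinate an element of \<open>I\<close> and an element of
      \<open>J\<close> add up to zero, so both vanish.\<close>
    then have "G.coord (d (?p x)) b = \<zero> \<and> G.coord (d (?q x)) b = \<zero>" if "b \<in> B'" for b
      using that dp by (intro sum_eq_zero) (auto simp: G.with_coords_in_def)
    then have "d (?p x) = \<zero>\<^bsub>G\<^esub>" "d (?q x) = \<zero>\<^bsub>G\<^esub>"
      using cG by (auto intro!: G.eq_if_coord_eq simp: G.coord_zero)
    then show ?thesis using c by (simp add: K_def a_kernel_def')
  qed
  show "\<exists>u\<in>C. \<exists>v\<in>K \<inter> F.with_coords_in J. x = u \<oplus>\<^bsub>F\<^esub> v" if x: "x \<in> K" for x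
    using pq[OF x] pqK[OF x] pw[OF x] qw[OF x] unfolding C_def by blast
  show "j \<odot>\<^bsub>F\<^esub> x = \<zero>\<^bsub>F\<^esub>" if "j \<in> J" "x \<in> C" for j x
  proof (rule F.eq_if_coord_eq)
    \<comment> \<open>The coordinates of \<open>x\<close> lie in \<open>I\<close>, and products of
      elements of \<open>J\<close> and \<open>I\<close> are zero.\<close>
    show "F.coord (j \<odot>\<^bsub>F\<^esub> x) b = F.coord \<zero>\<^bsub>F\<^esub> b" if "b \<in> B" for b
      using that \<open>j \<in> J\<close> \<open>x \<in> C\<close> swap.mult_zero J.Icarr
      by (auto simp: C_def F.with_coords_in_def F.coord_smult F.coord_zero)
  qed (use that J.Icarr in \<open>auto simp: C_def F.with_coords_in_def\<close>)
  have 1: "?p \<in> module_hom R (F\<lparr>carrier := K\<rparr>) (F\<lparr>carrier := C\<rparr>)"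
  proof (rule module_homI; simp)
    fix x assume "x \<in> K" then show "?p x \<in> C" using pw pqK by (simp add: C_def)
  next
    fix x y assume x: "x \<in> K" and y: "y \<in> K"
    have "?p (x \<oplus>\<^bsub>F\<^esub> y) = F.comb (\<lambda>b. ideal_proj R I J (F.coord x b) \<oplus> ideal_proj R I J (F.coord y b))"
      using x y p[OF x] p[OF y] KF cm pI(2)
      by (intro F.comb_cong) (auto simp: F.coord_add subset_iff)
    then show "?p (x \<oplus>\<^bsub>F\<^esub> y) = ?p x \<oplus>\<^bsub>F\<^esub> ?p y"
      using F.comb_add[OF p[OF x] p[OF y]] by simp
  next
    fix a x assume a: "a \<in> carrier R" and x: "x \<in> K"
    have "?p (a \<odot>\<^bsub>F\<^esub> x) = F.comb (\<lambda>b. a \<otimes> ideal_proj R I J (F.coord x b))"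
      using x a p[OF x] KF cm pI(3)
      by (intro F.comb_cong) (auto simp: F.coord_smult subset_iff)
    then show "?p (a \<odot>\<^bsub>F\<^esub> x) = a \<odot>\<^bsub>F\<^esub> ?p x"
      using F.comb_smult[OF p[OF x] a] by simp
  qed
  have 2: "(\<lambda>x. x) \<in> module_hom R (F\<lparr>carrier := C\<rparr>) (F\<lparr>carrier := K\<rparr>)"
    by (rule module_homI) (auto simp: C_def)
  have "?p x = x" if x: "x \<in> C" for x
  proof -
    have "?p x = F.comb (F.coord x)"
      using x ideal_proj_id I.Icarr by (intro F.comb_cong) (auto simp: C_def F.with_coords_in_def)
    also have "\<dots> = x" using x KF by (intro F.comb_coord) (auto simp: C_def)
    finally show ?thesis .
  qed
  then show "module_retract R (F\<lparr>carrier := C\<rparr>) (F\<lparr>carrier := K\<rparr>)"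
    unfolding module_retract_def
    by (intro bexI[OF bexI[OF _ 1] 2]) simp
qed

end


section \<open>Transport of resolutions along injections\<close>

text \<open>Copies the structure of \<open>M\<close> to the image of \<open>f\<close>;
  \<open>inv_into\<close> undoes \<open>f\<close> as long as \<open>f\<close> is injective on the
  carrier. It serves to move a resolution to the type fixed in \<open>proj_dim\<close>.\<close>

definition transport_module ::
  "('b \<Rightarrow> 'c) \<Rightarrow> ('a, 'b, 'n) module_scheme \<Rightarrow> ('a, 'c) module"
  where "transport_module f M =
    \<lparr>carrier = f ` carrier M, monoid.mult = (\<lambda>_ _. undefined), one = undefined, ring.zero = f \<zero>\<^bsub>M\<^esub>,
      ring.add = (\<lambda>x y. f (inv_into (carrier M) f x \<oplus>\<^bsub>M\<^esub> inv_into (carrier M) f y)),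
      smult = (\<lambda>a x. f (a \<odot>\<^bsub>M\<^esub> inv_into (carrier M) f x))\<rparr>"

lemma transport_module_simps [simp]:
  "carrier (transport_module f M) = f ` carrier M"
  "\<zero>\<^bsub>transport_module f M\<^esub> = f \<zero>\<^bsub>M\<^esub>"
  "x \<oplus>\<^bsub>transport_module f M\<^esub> y = f (inv_into (carrier M) f x \<oplus>\<^bsub>M\<^esub> inv_into (carrier M) f y)"
  "a \<odot>\<^bsub>transport_module f M\<^esub> x = f (a \<odot>\<^bsub>M\<^esub> inv_into (carrier M) f x)"
  by (simp_all add: transport_module_def)

lemma
  assumes "module R M" and inj: "inj_on f (carrier M)"
  shows module_transport: "module R (transport_module f M)"
    and transport_hom: "f \<in> module_hom R M (transport_module f M)"
    and transport_inv_hom: "inv_into (carrier M) f \<in> module_hom R (transport_module f M) M"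
proof -
  interpret M: module R M by fact
  note [simp] = inv_into_f_f[OF inj]
  show "module R (transport_module f M)"
  proof (intro moduleI abelian_groupI)
    fix x assume "x \<in> carrier (transport_module f M)"
    then show "\<exists>y\<in>carrier (transport_module f M).
        y \<oplus>\<^bsub>transport_module f M\<^esub> x = \<zero>\<^bsub>transport_module f M\<^esub>"
      by (auto intro!: bexI[of _ "\<ominus>\<^bsub>M\<^esub> _"] simp: M.M.l_neg)
  qed (auto simp: M.M.a_ac M.smult_l_distr M.smult_r_distr M.smult_assoc1 M.R.is_cring)
  show "f \<in> module_hom R M (transport_module f M)"
    by (rule module_homI) auto
  show "inv_into (carrier M) f \<in> module_hom R (transport_module f M) M"
    by (rule module_homI) auto
qed

text \<open>Conjugating the differentials by bijections onto the copies replaces kernels and images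
  by their copies, so exactness persists. The index \<open>n - 1\<close> belongs to the target of
  \<open>d n\<close>.\<close>

lemma resolution_transport:
  assumes res: "resolution R M F d e" and inj: "\<And>n. inj_on (f n) (carrier (F n))"
  defines "g \<equiv> \<lambda>n. inv_into (carrier (F n)) (f n)"
  shows "resolution R M (\<lambda>n. transport_module (f n) (F n))
    (\<lambda>n x. f (n - 1) (d n (g n x))) (\<lambda>x. e (g 0 x))"
proof -
  let ?T = "\<lambda>n. transport_module (f n) (F n)"
  have mF: "module R (F n)" for n using res by (simp add: resolution_def)
  have mM: "module R M" using res by (simp add: resolution_def)
  have e: "e \<in> module_hom R (F 0) M" and d: "d (Suc n) \<in> module_hom R (F (Suc n)) (F n)" for n
    using res by (auto simp: resolution_def)
  have gf [simp]: "g n (f n x) = x" if "x \<in> carrier (F n)" for n x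
    using that inj by (simp add: g_def)
  have T: "module R (?T n)" "f n \<in> module_hom R (F n) (?T n)" "g n \<in> module_hom R (?T n) (F n)" for n
    unfolding g_def
    by (rule module_transport transport_hom transport_inv_hom, rule mF, rule inj)+
  \<comment> \<open>By injectivity only zero is sent to the zero of the copy, so kernels
    correspond.\<close>
  have fz: "f n x = f n \<zero>\<^bsub>F n\<^esub> \<longleftrightarrow> x = \<zero>\<^bsub>F n\<^esub>" if "x \<in> carrier (F n)" for n x
  proof -
    interpret module R "F n" by (rule mF)
    show ?thesis using inj_on_eq_iff[OF inj that] by simp
  qed
  have ker_d: "a_kernel (?T (Suc n)) (?T n) (\<lambda>x. f n (d (Suc n) (g (Suc n) x))) =
      f (Suc n) ` a_kernel (F (Suc n)) (F n) (d (Suc n))" for n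
    using module_homD(1)[OF d] fz by (auto simp: a_kernel_def')
  have ker_e: "a_kernel (?T 0) M (\<lambda>x. e (g 0 x)) = f 0 ` a_kernel (F 0) M e"
    by (auto simp: a_kernel_def')
  have im_d: "(\<lambda>x. f n (d (Suc n) (g (Suc n) x))) ` carrier (?T (Suc n)) =
      f n ` d (Suc n) ` carrier (F (Suc n))" for n
    by (auto simp: image_image)
  show ?thesis
    unfolding resolution_def
  proof (intro conjI allI)
    show "(\<lambda>x. e (g 0 x)) \<in> module_hom R (?T 0) M" by (rule module_hom_comp[OF T(3) e])
    show "(\<lambda>x. f (Suc n - 1) (d (Suc n) (g (Suc n) x))) \<in> module_hom R (?T (Suc n)) (?T n)" for n
      using module_hom_comp[OF module_hom_comp[OF T(3) d] T(2)] by simp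
    show "(\<lambda>x. e (g 0 x)) ` carrier (?T 0) = carrier M"
      using res by (simp add: resolution_def image_image)
    show "(\<lambda>x. f (1 - 1) (d 1 (g 1 x))) ` carrier (?T 1) = a_kernel (?T 0) M (\<lambda>x. e (g 0 x))"
      using res im_d[of 0] ker_e by (simp add: resolution_def)
    show "(\<lambda>x. f (Suc (Suc n) - 1) (d (Suc (Suc n)) (g (Suc (Suc n)) x))) ` carrier (?T (Suc (Suc n)))
        = a_kernel (?T (Suc n)) (?T n) (\<lambda>x. f (Suc n - 1) (d (Suc n) (g (Suc n) x)))" for n
      using res im_d[of "Suc n"] ker_d[of n] by (simp add: resolution_def)
  qed (rule mM, rule T(1))
qed

text \<open>An element is determined by the list of its coordinates along an enumeration of the
  basis, so a finite-rank free module over any type fits into the lists used in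
  \<open>proj_dim\<close>.\<close>

lemma (in free_basis) ex_inj_list: "\<exists>f :: 'c \<Rightarrow> ('a + 'b) list. inj_on f (carrier F)"
proof -
  obtain bs where bs: "set bs = B" using finite_list[OF finite_basis] by blast
  have "inj_on (\<lambda>x. map (\<lambda>b. Inl (coord x b) :: 'a + 'b) bs) (carrier F)"
    by (rule inj_onI) (use bs in \<open>auto intro: eq_if_coord_eq\<close>)
  then show ?thesis by blast
qed

section \<open>Finite projective dimension from a vanishing second syzygy\<close>

lemma module_retract_trans:
  assumes "module_retract R L M" and "module_retract R M N"
  shows "module_retract R L N"
proof -
  obtain h r where h: "h \<in> module_hom R L M" and r: "r \<in> module_hom R M L"
    and rh: "\<And>x. x \<in> carrier L \<Longrightarrow> r (h x) = x"
    using assms(1) by (auto simp: module_retract_def)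
  obtain h' r' where h': "h' \<in> module_hom R M N" and r': "r' \<in> module_hom R N M"
    and rh': "\<And>x. x \<in> carrier M \<Longrightarrow> r' (h' x) = x"
    using assms(2) by (auto simp: module_retract_def)
  show ?thesis
    unfolding module_retract_def
    by (intro bexI[OF bexI[OF _ module_hom_comp[OF r' r]] module_hom_comp[OF h h']])
      (simp add: rh rh' module_homD(1)[OF h])
qed

text \<open>If the image of \<open>d 2\<close> is zero, then \<open>d 1\<close> is injective, and
  cutting the resolution off after \<open>F 1\<close> leaves a projective resolution of length at
  most 1. It is then transported to the type that \<open>proj_dim\<close> quantifies over.\<close>

lemma proj_dim_finite_if_second_syzygy_zero:
  fixes R :: "('a, 'm) ring_scheme" and M :: "('a, 'b, 'n) module_scheme"
    and F :: "nat \<Rightarrow> ('a, 'c, 'k) module_scheme"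
  assumes res: "resolution R M F d e" and free: "\<And>n. finite_rank_free_module R (F n)"
    and zero: "d 2 ` carrier (F 2) = {\<zero>\<^bsub>F 1\<^esub>}"
  shows "proj_dim R M \<noteq> \<infinity>"
proof -
  \<comment> \<open>The truncation: zero modules in degrees above 1, kept as submodules of
    \<open>F n\<close> so that \<open>d\<close> need not be changed.\<close>
  define G where "G n = (if n \<le> 1 then F n else (F n)\<lparr>carrier := {\<zero>\<^bsub>F n\<^esub>}\<rparr>)" for n
  have mF: "module R (F n)" for n using res by (simp add: resolution_def)
  have d: "d (Suc n) \<in> module_hom R (F (Suc n)) (F n)" for n
    using res by (simp add: resolution_def)
  have dz: "d (Suc n) \<zero>\<^bsub>F (Suc n)\<^esub> = \<zero>\<^bsub>F n\<^esub>" for n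
    by (rule module_hom_zero[OF mF mF d])
  have sub: "submodule {\<zero>\<^bsub>F n\<^esub>} R (F n)" for n
  proof -
    interpret module R "F n" by (rule mF)
    show ?thesis by (rule submoduleI) auto
  qed
  have mG: "module R (G n)" for n
    using mF submodule.submodule_is_module[OF sub mF] by (simp add: G_def)
  have ret: "module_retract R (G n) (F n)" for n
  proof (cases "n \<le> 1")
    case True
    then show ?thesis
      by (auto simp: G_def module_retract_def module_hom_def intro!: bexI[of _ "\<lambda>x. x"])
  next
    case False
    interpret module R "F n" by (rule mF)
    show ?thesis
      using False unfolding module_retract_def
      by (intro bexI[of _ "\<lambda>_. \<zero>\<^bsub>F n\<^esub>"] module_homI) (auto simp: G_def)
  qed
  have resG: "resolution R M G d e"
    unfolding resolution_def
  proof (intro conjI allI)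
    show "d (Suc n) \<in> module_hom R (G (Suc n)) (G n)" for n
    proof -
      interpret F: module R "F n" by (rule mF)
      interpret F': module R "F (Suc n)" by (rule mF)
      show ?thesis
        using module_homD[OF d[of n]] dz[of n]
        by (intro module_homI) (auto simp: G_def split: if_splits)
    qed
    show "d (Suc (Suc n)) ` carrier (G (Suc (Suc n))) = a_kernel (G (Suc n)) (G n) (d (Suc n))" for n
    \<comment> \<open>Exactness at \<open>G 1\<close> is where the hypothesis on \<open>d 2\<close>
      enters; in higher degrees both sides are zero.\<close>
    proof (cases n)
      case 0
      have "d (Suc (Suc 0)) ` carrier (F (Suc (Suc 0))) = a_kernel (F (Suc 0)) (F 0) (d (Suc 0))"
        using res by (simp add: resolution_def)
      then show ?thesis
        using 0 zero dz[of "Suc 0"] by (simp add: G_def numeral_2_eq_2)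
    next
      case (Suc k)
      then show ?thesis
        using dz[of "Suc (Suc k)"] dz[of "Suc k"] by (auto simp: G_def a_kernel_def')
    qed
  qed (use res mG in \<open>auto simp: resolution_def G_def\<close>)
  have "\<exists>f :: 'c \<Rightarrow> ('a + 'b) list. inj_on f (carrier (F n))" for n
    using free[of n] free_basis.ex_inj_list by (auto simp: finite_rank_free_module_iff_ex_basis)
  then obtain f :: "nat \<Rightarrow> 'c \<Rightarrow> ('a + 'b) list" where "\<And>n. inj_on (f n) (carrier (F n))" by metis
  moreover have "carrier (G n) \<subseteq> carrier (F n)" for n
    using submodule.axioms(1)[OF sub[of n]] by (auto simp: G_def dest: subgroup.subset)
  ultimately have f: "inj_on (f n) (carrier (G n))" for n
    using inj_on_subset by blast
  have proj: "projective_module R (transport_module (f n) (G n))" for n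
  proof -
    obtain B where B: "free_basis R (F n) B"
      using free[of n] finite_rank_free_module_iff_ex_basis by blast
    \<comment> \<open>The copy is a retract of \<open>G n\<close>, hence of the free module
      \<open>F n\<close>.\<close>
    have "module_retract R (transport_module (f n) (G n)) (G n)"
      unfolding module_retract_def
      using transport_hom[OF mG f] transport_inv_hom[OF mG f]
      by (intro bexI[of _ "inv_into (carrier (G n)) (f n)"] bexI[of _ "f n"]) (auto simp: f_inv_into_f)
    then show ?thesis
      by (intro free_basis.retract_imp_projective[OF B] module_transport[OF mG f]
          module_retract_trans[OF _ ret])
  qed
  have "\<forall>i>1. carrier (transport_module (f i) (G i)) = {\<zero>\<^bsub>transport_module (f i) (G i)\<^esub>}"
    by (auto simp: G_def)
  then have "proj_dim R M \<le> enat 1"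
    unfolding proj_dim_def
    using resolution_transport[OF resG f] proj by (intro Inf_lower) blast
  then show ?thesis by (metis enat_ord_simps(5) infinity_ne_i1 one_enat_def)
qed

section \<open>Minimal resolutions over a local ring with decomposable maximal ideal\<close>

context decomposed_local_cring
begin

text \<open>\<open>retract_kernel\<close> is applied twice: first to the part of the second syzygy
  with coordinates in \<open>I\<close>, which is killed by \<open>J\<close>, and then to the copy of
  \<open>J\<close> in the third syzygy, which is killed by \<open>I\<close>.\<close>

lemma retract_of_syzygies:
  assumes res: "resolution R M F d e" and B: "\<And>n. free_basis R (F n) (B n)"
    and min: "\<And>n. d (Suc n) ` carrier (F (Suc n)) \<subseteq> free_basis.with_coords_in R (F n) (B n) \<mm>"
    and ne: "a_kernel (F 1) (F 0) (d 1) \<inter> free_basis.with_coords_in R (F 1) (B 1) I \<noteq> {\<zero>\<^bsub>F 1\<^esub>}"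
  shows "module_retract R (ideal_module R J) (syzygy F d 3)"
    and "J \<noteq> {\<zero>} \<Longrightarrow> module_retract R (ideal_module R I) (syzygy F d 4)"
proof -
  interpret swap: decomposed_local_cring R \<mm> J I
    using inter_zero sum_eq set_add_comm[OF I.a_subset J.a_subset] by unfold_locales auto
  have d: "d (Suc n) \<in> module_hom R (F (Suc n)) (F n)" for n
    using res by (simp add: resolution_def)
  have d1: "d 1 \<in> module_hom R (F 1) (F 0)" and d2: "d 2 \<in> module_hom R (F 2) (F 1)"
    and d3: "d 3 \<in> module_hom R (F 3) (F 2)"
    using d[of 0] d[of 1] d[of 2] by (simp_all add: numeral_eq_Suc)
  have mF: "module R (F n)" for n using res by (simp add: resolution_def)
  have ex: "d (Suc (Suc n)) ` carrier (F (Suc (Suc n))) = a_kernel (F (Suc n)) (F n) (d (Suc n))" for n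
    using res by (simp add: resolution_def)
  \<comment> \<open>By exactness the syzygy with index \<open>n + 1\<close> is the kernel of
    \<open>d n\<close> inside \<open>F n\<close>, the form in which \<open>retract_kernel\<close>
    produces retracts.\<close>
  have ex2: "d 2 ` carrier (F 2) = a_kernel (F 1) (F 0) (d 1)"
    and ex3: "d 3 ` carrier (F 3) = a_kernel (F 2) (F 1) (d 2)"
    and ex4: "d 4 ` carrier (F 4) = a_kernel (F 3) (F 2) (d 3)"
    using ex[of 0] ex[of 1] ex[of 2] by (simp_all add: numeral_eq_Suc)
  have min1: "a_kernel (F 1) (F 0) (d 1) \<subseteq> free_basis.with_coords_in R (F 1) (B 1) \<mm>"
    and min2: "a_kernel (F 2) (F 1) (d 2) \<subseteq> free_basis.with_coords_in R (F 2) (B 2) \<mm>"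
    and min3: "a_kernel (F 3) (F 2) (d 3) \<subseteq> free_basis.with_coords_in R (F 3) (B 3) \<mm>"
    unfolding ex2[symmetric] ex3[symmetric] ex4[symmetric]
    using min[of 1] min[of 2] min[of 3] by (simp_all add: numeral_eq_Suc)
  note part = kernel_part[OF B B d1 min1]
  have "module_retract R (ideal_module R J) ((F 2)\<lparr>carrier := a_kernel (F 2) (F 1) (d 2)\<rparr>)"
    using ne part(2,3)
    by (intro swap.retract_kernel[OF B mF d2 min2 submodule.submodule_is_module[OF part(1) mF]])
      (auto simp: ex2)
  then show 1: "module_retract R (ideal_module R J) (syzygy F d 3)"
    by (simp add: syzygy_def ex3)
  assume "J \<noteq> {\<zero>}"
  have "module_retract R (ideal_module R I) ((F 3)\<lparr>carrier := a_kernel (F 3) (F 2) (d 3)\<rparr>)"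
    using 1 \<open>J \<noteq> {\<zero>}\<close> mult_zero
    by (intro retract_kernel[OF B mF d3 min3 module_ideal_module[OF is_cring J.is_ideal]])
      (auto simp: syzygy_def)
  then show "module_retract R (ideal_module R I) (syzygy F d 4)"
    by (simp add: syzygy_def ex4)
qed

text \<open>Here \<open>J\<close> comes from the third syzygy and \<open>I\<close> from the fourth,
  so \<open>retract_sum\<close> is used with the two ideals exchanged.\<close>

lemma retract_of_third_and_fourth_syzygy:
  assumes "resolution R M F d e" and "\<And>n. free_basis R (F n) (B n)"
    and "\<And>n. d (Suc n) ` carrier (F (Suc n)) \<subseteq> free_basis.with_coords_in R (F n) (B n) \<mm>"
    and "a_kernel (F 1) (F 0) (d 1) \<inter> free_basis.with_coords_in R (F 1) (B 1) I \<noteq> {\<zero>\<^bsub>F 1\<^esub>}"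
    and "J \<noteq> {\<zero>}"
    and "module R (syzygy F d 3)" and "module R (syzygy F d 4)"
  shows "module_retract R (ideal_module R \<mm>) (direct_sum (syzygy F d 3) (syzygy F d 4))"
proof -
  interpret swap: ideal_pair R J I
    using inter_zero by unfold_locales auto
  show ?thesis
    using swap.retract_sum[OF assms(6,7) retract_of_syzygies[OF assms(1-4)]] assms(5)
      set_add_comm[OF I.a_subset J.a_subset] sum_eq by simp
qed

end

text \<open>The additional summand is filled with zero by the inclusion and forgotten by the
  retraction.\<close>

lemma module_retract_direct_sum_extend:
  assumes "module R C" and "module_retract R N (direct_sum A B)"
  shows "module_retract R N (direct_sum A (direct_sum B C))"
proof -
  interpret C: module R C by fact
  have "module_retract R (direct_sum A B) (direct_sum A (direct_sum B C))"
    unfolding module_retract_def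
    by (intro bexI[of _ "\<lambda>(x, y, z). (x, y)"] bexI[of _ "\<lambda>(x, y). (x, y, \<zero>\<^bsub>C\<^esub>)"] module_homI) auto
  then show ?thesis using module_retract_trans[OF assms(2)] by blast
qed

theorem theorem1:
  fixes R :: "('a, 'm) ring_scheme" and \<mm> :: "'a set"
    and M :: "('a, 'b, 'n) module_scheme"
    and F :: "nat \<Rightarrow> ('a, 'c, 'k) module_scheme"
    and d :: "nat \<Rightarrow> 'c \<Rightarrow> 'c" and e :: "'c \<Rightarrow> 'b"
  assumes "noetherian_ring R" and "local_ring R \<mm>"
    and "decomposable_ideal R \<mm>"
    and "finitely_generated_module R M"
    and "proj_dim R M = \<infinity>"
    and "minimal_free_resolution R \<mm> M F d e"
  shows "isomorphic_to_direct_summand R (ideal_module R \<mm>)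
    (direct_sum (syzygy F d 3) (direct_sum (syzygy F d 4) (syzygy F d 5)))"
proof -
  interpret cring R using assms(2) by (simp add: local_ring_def)
  interpret maximalideal \<mm> R using assms(2) by (simp add: local_ring_def)
  interpret local_cring R \<mm>
    using noetherian_local_ring_units[OF assms(1,2)] I_notcarr one_imp_carrier by unfold_locales auto
  obtain I J where IJ: "ideal I R" "ideal J R" "I \<noteq> {\<zero>\<^bsub>R\<^esub>}" "J \<noteq> {\<zero>\<^bsub>R\<^esub>}" "I \<inter> J = {\<zero>\<^bsub>R\<^esub>}"
    "I <+>\<^bsub>R\<^esub> J = \<mm>"
    using assms(3) by (auto simp: decomposable_ideal_def)
  interpret I: ideal I R by fact
  interpret J: ideal J R by fact
  interpret decomposed_local_cring R \<mm> I J
    using IJ by unfold_locales auto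
  interpret swap: decomposed_local_cring R \<mm> J I
    using IJ set_add_comm[OF I.a_subset J.a_subset] by unfold_locales auto
  have res: "resolution R M F d e" and free: "\<And>n. finite_rank_free_module R (F n)"
    and m: "\<And>n. d (Suc n) ` carrier (F (Suc n)) \<subseteq> ideal_times_module R \<mm> (F n)"
    using assms(6) by (auto simp: minimal_free_resolution_def)
  have "\<forall>n. \<exists>B. free_basis R (F n) B"
    using free by (simp add: finite_rank_free_module_iff_ex_basis)
  from choice[OF this] obtain B where B: "\<And>n. free_basis R (F n) (B n)" by blast
  have min: "d (Suc n) ` carrier (F (Suc n)) \<subseteq> free_basis.with_coords_in R (F n) (B n) \<mm>" for n
    using m free_basis.ideal_times_module_subset[OF B is_ideal] by blast
  have d: "d (Suc n) \<in> module_hom R (F (Suc n)) (F n)" and mF: "module R (F n)" for n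
    using res by (simp_all add: resolution_def)
  have syz: "module R (syzygy F d (Suc n))" for n
    using submodule.submodule_is_module[OF submodule_image[OF mF mF d] mF] by (simp add: syzygy_def)
  have m3: "module R (syzygy F d 3)" and m4: "module R (syzygy F d 4)" and m5: "module R (syzygy F d 5)"
    using syz[of 2] syz[of 3] syz[of 4] by (simp_all add: numeral_eq_Suc)
  let ?K = "a_kernel (F 1) (F 0) (d 1)"
  interpret F1: free_basis R "F 1" "B 1" by (rule B)
  have d1: "d 1 \<in> module_hom R (F 1) (F 0)" using d[of 0] by simp
  have K: "d 2 ` carrier (F 2) = ?K" using res by (auto simp: resolution_def numeral_2_eq_2)
  have Km: "?K \<subseteq> F1.with_coords_in \<mm>" using min[of 1] K by (simp add: numeral_2_eq_2)
  \<comment> \<open>\<open>?K\<close> is the second syzygy; if it vanished, the projective dimension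
    would be finite.\<close>
  have K_ne: "?K \<noteq> {\<zero>\<^bsub>F 1\<^esub>}"
    using proj_dim_finite_if_second_syzygy_zero[OF res free] assms(5) K by argo
  \<comment> \<open>Every element of \<open>?K\<close> is a sum of an element of each of these two
    intersections, so they cannot both be zero.\<close>
  have "?K \<inter> F1.with_coords_in I \<noteq> {\<zero>\<^bsub>F 1\<^esub>} \<or> ?K \<inter> F1.with_coords_in J \<noteq> {\<zero>\<^bsub>F 1\<^esub>}"
  proof (rule ccontr)
    assume no: "\<not> ?thesis"
    have "x = \<zero>\<^bsub>F 1\<^esub>" if x: "x \<in> ?K" for x
    proof -
      obtain u v where "u \<in> ?K \<inter> F1.with_coords_in I" "v \<in> ?K \<inter> F1.with_coords_in J"
        and "x = u \<oplus>\<^bsub>F 1\<^esub> v"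
        using kernel_part(4)[OF B B d1 Km x] by (elim bexE)
      moreover from this have "u = \<zero>\<^bsub>F 1\<^esub>" "v = \<zero>\<^bsub>F 1\<^esub>" using no by blast+
      ultimately show ?thesis using F1.M.l_zero[OF F1.M.zero_closed] by argo
    qed
    moreover have "\<zero>\<^bsub>F 1\<^esub> \<in> ?K"
      using module_hom_zero[OF mF mF d1] F1.M.zero_closed by (simp add: a_kernel_def')
    ultimately have "?K = {\<zero>\<^bsub>F 1\<^esub>}" by blast
    then show False using K_ne by blast
  qed
  \<comment> \<open>The two cases differ by exchanging \<open>I\<close> and \<open>J\<close>. In
    each, the ideal found in the third syzygy must be non-zero for the step to the fourth, whence
    \<open>IJ(4)\<close> and \<open>IJ(3)\<close>.\<close>
  then have "module_retract R (ideal_module R \<mm>) (direct_sum (syzygy F d 3) (syzygy F d 4))"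
    using retract_of_third_and_fourth_syzygy[OF res B min _ IJ(4) m3 m4]
      swap.retract_of_third_and_fourth_syzygy[OF res B min _ IJ(3) m3 m4] by blast
  then have "module_retract R (ideal_module R \<mm>)
      (direct_sum (syzygy F d 3) (direct_sum (syzygy F d 4) (syzygy F d 5)))"
    by (rule module_retract_direct_sum_extend[OF m5])
  then show ?thesis
    by (intro module_retract_imp_direct_summand module_ideal_module module_direct_sum
        m3 m4 m5 is_cring is_ideal)
qed

end
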